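(* Let $A$ be a commutative Noetherian ring with $1$, let $M$ be a free $A$-module of rank $n$ with basis $e_1,\dots,e_n$, let $\omega_1,\dots,\omega_r\in M$ ($r\ge 1$), and let $I\subseteq A$ be the ideal generated by the coefficients of $\omega_1\wedge\cdots\wedge\omega_r$ with respect to the basis $\{e_{i_1}\wedge\cdots\wedge e_{i_r}\mid 1\le i_1<\cdots<i_r\le n\}$ of $\wedge^rM$. Let $N$ be the $A$-submodule of $M$ spanned by $\omega_1,\dots,\omega_r$. Fix $s$, $1\le s\le r$, and let $\omega\in\wedge^kM$ satisfy $\gamma\wedge\omega=0$ for all $\gamma\in\wedge^sN$. (a) There exists $m\ge 0$ with the property that if $g\in I^m$, then $$g\omega=\sum_{\substack{J\subseteq\{1,\dots,r\}\\|J|=r-s+1}}\omega_J\wedge\alpha_J$$ for some $\alpha_J\in\wedge^{k-r+s-1}M$. (b) If $\mathrm{depth}(I)>0$ and $k<\mathrm{depth}(I)+r-s$, then there exist $\alpha_J\in\wedge^{k-r+s-1}M$ such that $$\omega=\sum_{\substack{J\subseteq\{1,\dots,r\}\\|J|=r-s+1}}\omega_J\wedge\alpha_J.$$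
   Context: For $J=\{j_1,\dots,j_t\}\subseteq\{1,\dots,r\}$ with $j_1<\cdots<j_t$, $\omega_J=\omega_{j_1}\wedge\cdots\wedge\omega_{j_t}$. The condition on $\omega$ means $\omega_J\wedge\omega=0$ in $\wedge^{k+s}M$ for every $J\subseteq\{1,\dots,r\}$ with $|J|=s$ (elements of $\wedge^sN$ act through their images in $\wedge^sM$, which are spanned by these $\omega_J$). $\wedge^kM$ is the $k$-th exterior power over $A$, with $\wedge^jM=0$ for $j<0$. $\mathrm{depth}(I)$ is the depth (grade) of the ideal $I$ on $A$, i.e. the maximal length of an $A$-regular sequence contained in $I$ (with $\mathrm{depth}(A)=\infty$ for the unit ideal). *)

theory Defs
  imports
    "HOL-Algebra.Algebra"
    "HOL-Algebra.Algebraic_Closure_Type"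
    "HOL-Library.Poly_Mapping"
    "HOL-Library.Extended_Nat"
begin

section \<open>Depth of an ideal\<close>

definition regular_sequence :: "('a, 'b) ring_scheme \<Rightarrow> 'a list \<Rightarrow> bool" where
  "regular_sequence R xs \<longleftrightarrow>
     set xs \<subseteq> carrier R \<and>
     (\<forall>i < length xs. \<forall>a \<in> carrier R.
        a \<otimes>\<^bsub>R\<^esub> (xs ! i) \<in> genideal R (set (take i xs)) \<longrightarrow> a \<in> genideal R (set (take i xs))) \<and>
     genideal R (set xs) \<noteq> carrier R"

definition depth :: "('a, 'b) ring_scheme \<Rightarrow> 'a set \<Rightarrow> enat" where
  "depth R I =
     (if I = carrier R then \<infinity>
      else (SUP xs \<in> {xs. set xs \<subseteq> I \<and> regular_sequence R xs}. enat (length xs)))"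


section \<open>Exterior algebra of a module\<close>

text \<open>
  Words under concatenation, written additively so that \<open>'m free_monoid \<Rightarrow>\<^sub>0 'a\<close> (with the
  convolution product of \<^theory>\<open>HOL-Library.Poly_Mapping\<close>) is the free associative
  \<open>'a\<close>-algebra on the set \<open>'m\<close>.
\<close>

datatype 'm free_monoid = Word (letters: "'m list")

instantiation free_monoid :: (type) monoid_add
begin

definition zero_free_monoid :: "'a free_monoid" where
  "0 = Word []"

definition plus_free_monoid :: "'a free_monoid \<Rightarrow> 'a free_monoid \<Rightarrow> 'a free_monoid" where
  "v + w = Word (letters v @ letters w)"

instance
  by standard (simp_all add: zero_free_monoid_def plus_free_monoid_def)

end

type_synonym ('a, 'm) free_alg = "'m free_monoid \<Rightarrow>\<^sub>0 'a"

abbreviation pure_tensor :: "'m list \<Rightarrow> ('a::comm_ring_1, 'm) free_alg" where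
  "pure_tensor xs \<equiv> Poly_Mapping.single (Word xs) 1"

abbreviation scalar :: "'a::comm_ring_1 \<Rightarrow> ('a, 'm) free_alg" where
  "scalar a \<equiv> Poly_Mapping.single 0 a"

text \<open>
  The exterior algebra of the module \<open>M = (UNIV :: 'm set)\<close> with scalar multiplication \<open>scale\<close>:
  the free algebra on the set \<open>M\<close> modulo the two-sided ideal generated by the linearity relations
  (which give the tensor algebra) and by the squares of the elements of \<open>M\<close>.
\<close>

definition ext_relations ::
  "('a::comm_ring_1 \<Rightarrow> 'm::ab_group_add \<Rightarrow> 'm) \<Rightarrow> ('a, 'm) free_alg set" where
  "ext_relations scale =
     {pure_tensor [x + y] - (pure_tensor [x] + pure_tensor [y]) | x y. True} \<union>
     {pure_tensor [scale a x] - scalar a * pure_tensor [x] | a x. True} \<union>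
     {pure_tensor [x] * pure_tensor [x] | x. True}"

definition ext_ideal ::
  "('a::comm_ring_1 \<Rightarrow> 'm::ab_group_add \<Rightarrow> 'm) \<Rightarrow> ('a, 'm) free_alg set" where
  "ext_ideal scale = genideal ring_of_type_algebra (ext_relations scale)"

definition ext_algebra ::
  "('a::comm_ring_1 \<Rightarrow> 'm::ab_group_add \<Rightarrow> 'm) \<Rightarrow> ('a, 'm) free_alg set ring" where
  "ext_algebra scale = ring_of_type_algebra Quot (ext_ideal scale)"

definition ext_class ::
  "('a::comm_ring_1 \<Rightarrow> 'm::ab_group_add \<Rightarrow> 'm) \<Rightarrow> ('a, 'm) free_alg \<Rightarrow> ('a, 'm) free_alg set" where
  "ext_class scale u = ext_ideal scale +>\<^bsub>ring_of_type_algebra\<^esub> u"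

definition ext_scale ::
  "('a::comm_ring_1 \<Rightarrow> 'm::ab_group_add \<Rightarrow> 'm) \<Rightarrow> 'a \<Rightarrow> ('a, 'm) free_alg set \<Rightarrow> ('a, 'm) free_alg set" where
  "ext_scale scale a \<eta> = ext_class scale (scalar a) \<otimes>\<^bsub>ext_algebra scale\<^esub> \<eta>"

text \<open>\<open>x\<^sub>1 \<and> \<dots> \<and> x\<^sub>k\<close> for a list \<open>[x\<^sub>1, \<dots>, x\<^sub>k]\<close> of elements of \<open>M\<close>:\<close>

definition wedge_list ::
  "('a::comm_ring_1 \<Rightarrow> 'm::ab_group_add \<Rightarrow> 'm) \<Rightarrow> 'm list \<Rightarrow> ('a, 'm) free_alg set" where
  "wedge_list scale xs = ext_class scale (pure_tensor xs)"

definition wedge_family ::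
  "('a::comm_ring_1 \<Rightarrow> 'm::ab_group_add \<Rightarrow> 'm) \<Rightarrow> (nat \<Rightarrow> 'm) \<Rightarrow> nat set \<Rightarrow> ('a, 'm) free_alg set" where
  "wedge_family scale x J = wedge_list scale (map x (sorted_list_of_set J))"

text \<open>
  For a submodule \<open>N\<close> of \<open>M\<close>, the image of the \<open>k\<close>-th exterior power of \<open>N\<close> in the exterior
  algebra of \<open>M\<close>: the \<open>'a\<close>-linear combinations of the \<open>x\<^sub>1 \<and> \<dots> \<and> x\<^sub>k\<close> with all \<open>x\<^sub>i \<in> N\<close>.
  It is the zero submodule for negative \<open>k\<close>.
\<close>

definition ext_power_image ::
  "('a::comm_ring_1 \<Rightarrow> 'm::ab_group_add \<Rightarrow> 'm) \<Rightarrow> 'm set \<Rightarrow> int \<Rightarrow> ('a, 'm) free_alg set set" where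
  "ext_power_image scale N k =
     ext_class scale `
       {u. \<forall>v \<in> Poly_Mapping.keys u. int (length (letters v)) = k \<and> set (letters v) \<subseteq> N}"

definition ext_power ::
  "('a::comm_ring_1 \<Rightarrow> 'm::ab_group_add \<Rightarrow> 'm) \<Rightarrow> int \<Rightarrow> ('a, 'm) free_alg set set" where
  "ext_power scale k = ext_power_image scale UNIV k"

lemma ring_ring_of_type_algebra: "ring (ring_of_type_algebra :: 'a::ring_1 ring)"
proof -
  have "\<exists>y. x + y = 0" for x :: 'a
    using add.right_inverse by blast
  thus ?thesis
    unfolding ring_of_type_algebra_def using add.right_inverse
    by unfold_locales (auto simp: algebra_simps Units_def)
qed

lemma ideal_ext_ideal:
  "ideal (ext_ideal scale) (ring_of_type_algebra :: ('a::comm_ring_1, 'm::ab_group_add) free_alg ring)"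
  unfolding ext_ideal_def
  by (rule ring.genideal_ideal[OF ring_ring_of_type_algebra]) (simp add: ring_of_type_algebra_def)

lemma ring_ext_algebra: "ring (ext_algebra scale)"
  unfolding ext_algebra_def by (rule ideal.quotient_is_ring[OF ideal_ext_ideal])

lemma ext_class_mult:
  "ext_class scale u \<otimes>\<^bsub>ext_algebra scale\<^esub> ext_class scale v = ext_class scale (u * v)"
proof -
  have "ext_class scale u \<otimes>\<^bsub>ext_algebra scale\<^esub> ext_class scale v =
      ext_class scale (u \<otimes>\<^bsub>ring_of_type_algebra\<^esub> v)"
    using ideal.rcoset_mult_add[OF ideal_ext_ideal, of u v scale]
    by (simp add: ext_class_def ext_algebra_def FactRing_def ring_of_type_algebra_def)
  thus ?thesis by (simp add: ring_of_type_algebra_def)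
qed

lemma wedge_list_append:
  "wedge_list scale xs \<otimes>\<^bsub>ext_algebra scale\<^esub> wedge_list scale ys = wedge_list scale (xs @ ys)"
  by (simp add: wedge_list_def ext_class_mult mult_single plus_free_monoid_def)

lemma wedge_list_square: "wedge_list scale [x, x] = \<zero>\<^bsub>ext_algebra scale\<^esub>"
proof -
  interpret ideal "ext_ideal scale" ring_of_type_algebra
    by (rule ideal_ext_ideal)
  have "pure_tensor [x] * pure_tensor [x] \<in> ext_ideal scale"
    unfolding ext_ideal_def genideal_def ext_relations_def by blast
  hence "pure_tensor [x, x] \<in> ext_ideal scale"
    by (simp add: mult_single plus_free_monoid_def)
  thus ?thesis
    by (simp add: wedge_list_def ext_class_def ext_algebra_def FactRing_def a_rcos_const)
qed

end

theory Submission
  imports Defs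
begin

text \<open>
  Write \<open>W\<^sub>t\<close> for the module of sums \<open>\<Sum>\<^sub>|\<^sub>J\<^sub>|\<^sub>=\<^sub>t \<omega>\<^sub>J \<and> \<alpha>\<^sub>J\<close>. Contracting \<open>\<omega>\<^sub>1 \<and> \<dots> \<and> \<omega>\<^sub>r \<and> \<eta>\<close> with the \<open>r\<close> dual basis
  vectors indexed by \<open>S\<close> gives, modulo \<open>W\<^sub>1\<close>, plus or minus the coefficient \<open>c\<^sub>S\<close> times \<open>\<eta>\<close>. Hence if
  \<open>\<omega>\<^sub>1 \<and> \<dots> \<and> \<omega>\<^sub>r \<and> \<eta> = 0\<close> then \<open>I \<eta> \<subseteq> W\<^sub>1\<close>. Moreover, if \<open>\<eta> = \<Sum>\<^sub>|\<^sub>J\<^sub>|\<^sub>=\<^sub>t \<omega>\<^sub>J \<and> \<alpha>\<^sub>J\<close> is killed by all \<open>\<omega>\<^sub>K\<close> with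
  \<open>|K| = r - t\<close>, then \<open>\<omega>\<^sub>1 \<and> \<dots> \<and> \<omega>\<^sub>r\<close> kills every \<open>\<alpha>\<^sub>J\<close>. Alternating the two observations yields (a) with
  \<open>m = r - s + 1\<close>.

  For (b) let \<open>a\<close> be the first element of a regular sequence in \<open>I\<close>. By (a) it suffices to cancel \<open>a\<close>
  from \<open>a \<eta> \<in> W\<^sub>t\<close>. Modulo \<open>a\<close> the coefficients \<open>\<alpha>\<^sub>J\<close> of \<open>a \<eta>\<close> are killed by \<open>\<omega>\<^sub>1 \<and> \<dots> \<and> \<omega>\<^sub>r\<close>, so by induction on
  the length of the sequence they lie in \<open>W\<^sub>1\<close> modulo \<open>a\<close>. Subtracting from \<open>\<eta>\<close> an element of \<open>W\<^sub>t\<close>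
  one reaches \<open>a \<eta>' \<in> W\<^sub>t\<^sub>+\<^sub>1\<close>, and the process stops because \<open>W\<^sub>r\<^sub>+\<^sub>1 = 0\<close>. Quotient rings are avoided by
  carrying an ideal \<open>q\<close> along and working modulo forms with coefficients in \<open>q\<close>.
\<close>

section \<open>The Fock space model of the exterior algebra\<close>

text \<open>The coefficient at \<open>S\<close> is that of the product of the \<open>e\<^sub>i\<close>, \<open>i \<in> S\<close>, in increasing order. Infinite \<open>S\<close> are
  allowed but play no role.\<close>

typedef 'a form = "UNIV :: (nat set \<Rightarrow> 'a) set"
  morphisms coef Form
  by simp

lemma coef_Form [simp]: "coef (Form h) S = h S"
  by (simp add: Form_inverse)

lemma form_eq_iff: "f = g \<longleftrightarrow> (\<forall>S. coef f S = coef g S)"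
  by (metis coef_inject ext)

instantiation form :: (ab_group_add) ab_group_add
begin

definition zero_form :: "'a form" where
  "0 = Form (\<lambda>S. 0)"

definition plus_form :: "'a form \<Rightarrow> 'a form \<Rightarrow> 'a form" where
  "f + g = Form (\<lambda>S. coef f S + coef g S)"

definition uminus_form :: "'a form \<Rightarrow> 'a form" where
  "- f = Form (\<lambda>S. - coef f S)"

definition minus_form :: "'a form \<Rightarrow> 'a form \<Rightarrow> 'a form" where
  "f - g = Form (\<lambda>S. coef f S - coef g S)"

instance
  by standard (auto simp: form_eq_iff zero_form_def plus_form_def uminus_form_def minus_form_def)

end

lemma coef_simps [simp]:
  "coef 0 S = 0"
  "coef (f + g) S = coef f S + coef g S"
  "coef (- f) S = - coef f S"
  "coef (f - g) S = coef f S - coef g S"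
  by (simp_all add: zero_form_def plus_form_def uminus_form_def minus_form_def)

section \<open>Signs and scalar multiplication of forms\<close>

definition below_sign :: "nat \<Rightarrow> nat set \<Rightarrow> 'a::comm_ring_1" where
  "below_sign i S = (-1) ^ card {j \<in> S. j < i}"

lemma below_sign_insert: "i \<notin> S \<Longrightarrow> below_sign j (insert i S) = (if i < j then - below_sign j S else below_sign j S)"
proof -
  assume "i \<notin> S"
  moreover have "{l \<in> insert i S. l < j} = (if i < j then insert i {l \<in> S. l < j} else {l \<in> S. l < j})"
    by auto
  moreover have "finite {l \<in> S. l < j}"
    by (rule finite_subset[of _ "{..<j}"]) auto
  ultimately show ?thesis by (simp add: below_sign_def)
qed

lemma below_sign_remove: "i \<in> S \<Longrightarrow> below_sign j (S - {i}) = (if i < j then - below_sign j S else below_sign j S)"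
proof -
  assume "i \<in> S"
  hence "below_sign j S = (if i < j then - below_sign j (S - {i}) else below_sign j (S - {i}))"
    using below_sign_insert[of i "S - {i}" j] by (simp add: insert_absorb)
  thus ?thesis by (metis minus_minus)
qed

lemma below_sign_eq_1: "(\<And>j. j \<in> S \<Longrightarrow> i \<le> j) \<Longrightarrow> below_sign i S = 1"
proof -
  assume "\<And>j. j \<in> S \<Longrightarrow> i \<le> j"
  hence "{j \<in> S. j < i} = {}" by fastforce
  thus ?thesis by (simp only: below_sign_def card.empty power_0)
qed

lemma below_sign_square: "below_sign i S * below_sign i S = 1"
  by (simp add: below_sign_def flip: power_mult_distrib)

definition smul :: "'a::comm_ring_1 \<Rightarrow> 'a form \<Rightarrow> 'a form" where
  "smul a f = Form (\<lambda>S. a * coef f S)"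

lemma coef_smul [simp]: "coef (smul a f) S = a * coef f S"
  by (simp add: smul_def)

lemma smul_smul [simp]: "smul a (smul b f) = smul (a * b) f"
  by (simp add: form_eq_iff mult.assoc)

lemma smul_one [simp]: "smul 1 f = f"
  by (simp add: form_eq_iff)

lemma smul_zero [simp]: "smul 0 f = 0" "smul a 0 = 0"
  by (auto simp: form_eq_iff)

lemma smul_add: "smul a (f + g) = smul a f + smul a g"
  by (simp add: form_eq_iff algebra_simps)

lemma smul_diff: "smul a (f - g) = smul a f - smul a g"
  by (simp add: form_eq_iff algebra_simps)

lemma smul_add_left: "smul (a + b) f = smul a f + smul b f"
  by (simp add: form_eq_iff algebra_simps)

lemma diff_eq_smul: "f - g = f + smul (-1) g"
  by (simp add: form_eq_iff)

lemma coef_sum: "coef (\<Sum>a\<in>A. f a) S = (\<Sum>a\<in>A. coef (f a) S)"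
  by (induction A rule: infinite_finite_induct) auto

lemma smul_sum: "smul a (\<Sum>x\<in>A. f x) = (\<Sum>x\<in>A. smul a (f x))"
  by (simp add: form_eq_iff coef_sum sum_distrib_left)

section \<open>Forms modulo an ideal and operators compatible with it\<close>

definition is_ideal :: "'a::comm_ring_1 set \<Rightarrow> bool" where
  "is_ideal q \<longleftrightarrow> 0 \<in> q \<and> (\<forall>x\<in>q. \<forall>y\<in>q. x + y \<in> q) \<and> (\<forall>a. \<forall>x\<in>q. a * x \<in> q)"

lemma is_ideal_zero: "is_ideal {0}"
  by (simp add: is_ideal_def)

lemma is_ideal_diff:
  assumes "is_ideal q" "x \<in> q" "y \<in> q" shows "x - y \<in> q"
proof -
  have "(-1) * y \<in> q" using assms unfolding is_ideal_def by blast
  hence "x + (-1) * y \<in> q" using assms unfolding is_ideal_def by blast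
  thus ?thesis by simp
qed

definition forms_in :: "'a::comm_ring_1 set \<Rightarrow> 'a form set" where
  "forms_in q = {f. \<forall>S. coef f S \<in> q}"

lemma forms_in_zero [simp]: "forms_in {0} = {0}"
  by (auto simp: forms_in_def form_eq_iff)

lemma forms_in_0: "is_ideal q \<Longrightarrow> 0 \<in> forms_in q"
  by (simp add: forms_in_def is_ideal_def)

lemma forms_in_add: "is_ideal q \<Longrightarrow> f \<in> forms_in q \<Longrightarrow> g \<in> forms_in q \<Longrightarrow> f + g \<in> forms_in q"
  by (simp add: forms_in_def is_ideal_def)

lemma forms_in_diff: "is_ideal q \<Longrightarrow> f \<in> forms_in q \<Longrightarrow> g \<in> forms_in q \<Longrightarrow> f - g \<in> forms_in q"
  by (simp add: forms_in_def is_ideal_diff)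

lemma forms_in_smul: "is_ideal q \<Longrightarrow> f \<in> forms_in q \<Longrightarrow> smul a f \<in> forms_in q"
  by (simp add: forms_in_def is_ideal_def)

lemma forms_in_sum: "is_ideal q \<Longrightarrow> (\<And>x. x \<in> A \<Longrightarrow> f x \<in> forms_in q) \<Longrightarrow> sum f A \<in> forms_in q"
  by (induction A rule: infinite_finite_induct) (auto simp: forms_in_0 forms_in_add)

text \<open>Signs from reordering are carried only as some \<open>\<epsilon>\<close> with
  \<open>\<epsilon> * \<epsilon> = 1\<close>; that equation alone suffices to remove them.\<close>

lemma forms_in_smul_unit:
  assumes "is_ideal q" "smul \<epsilon> f \<in> forms_in q" "\<epsilon> * \<epsilon> = 1" shows "f \<in> forms_in q"
  using forms_in_smul[OF assms(1,2), of \<epsilon>] assms(3) by simp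

text \<open>The last clause says that the operator descends modulo every ideal. It is imposed
  separately because forms may have infinitely many nonzero coefficients: for an ideal that is not
  finitely generated, linearity alone does not give it.\<close>

definition linop :: "('a::comm_ring_1 form \<Rightarrow> 'a form) \<Rightarrow> bool" where
  "linop T \<longleftrightarrow> (\<forall>f g. T (f + g) = T f + T g) \<and> (\<forall>a f. T (smul a f) = smul a (T f))
     \<and> (\<forall>q f. is_ideal q \<longrightarrow> f \<in> forms_in q \<longrightarrow> T f \<in> forms_in q)"

lemma linop_add: "linop T \<Longrightarrow> T (f + g) = T f + T g"
  and linop_smul: "linop T \<Longrightarrow> T (smul a f) = smul a (T f)"
  and linop_forms_in: "linop T \<Longrightarrow> is_ideal q \<Longrightarrow> f \<in> forms_in q \<Longrightarrow> T f \<in> forms_in q"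
  by (auto simp: linop_def)

lemma linop_zero: "linop T \<Longrightarrow> T 0 = 0"
  using linop_smul[of T 0 0] by simp

lemma linop_diff: "linop T \<Longrightarrow> T (f - g) = T f - T g"
  by (simp only: diff_eq_smul linop_add linop_smul)

lemma linop_sum: "linop T \<Longrightarrow> T (\<Sum>x\<in>A. f x) = (\<Sum>x\<in>A. T (f x))"
  by (induction A rule: infinite_finite_induct) (auto simp: linop_zero linop_add)

lemma linop_foldr: "(\<And>x. linop (T x)) \<Longrightarrow> linop (foldr T xs)"
  by (induction xs) (auto simp: linop_def)

lemma linop_fold: "(\<And>x. linop (T x)) \<Longrightarrow> linop (fold T xs)"
  by (induction xs) (auto simp: linop_def)

text \<open>Left multiplication by \<open>e\<^sub>i\<close> and contraction with the dual vector of \<open>e\<^sub>i\<close>; they satisfy the canonical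
  anticommutation relations, and no product of forms is needed beyond them.\<close>

definition create :: "nat \<Rightarrow> 'a::comm_ring_1 form \<Rightarrow> 'a form" where
  "create i f = Form (\<lambda>S. if i \<in> S then below_sign i S * coef f (S - {i}) else 0)"

definition annih :: "nat \<Rightarrow> 'a::comm_ring_1 form \<Rightarrow> 'a form" where
  "annih i f = Form (\<lambda>S. if i \<in> S then 0 else below_sign i S * coef f (insert i S))"

definition vec_mult :: "nat \<Rightarrow> (nat \<Rightarrow> 'a::comm_ring_1) \<Rightarrow> 'a form \<Rightarrow> 'a form" where
  "vec_mult n x f = (\<Sum>i\<in>{1..n}. smul (x i) (create i f))"

lemma linop_create: "linop (create i)"
  unfolding linop_def
  by (auto simp: create_def form_eq_iff algebra_simps forms_in_def is_ideal_def)

lemma linop_annih: "linop (annih i)"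
  unfolding linop_def
  by (auto simp: annih_def form_eq_iff algebra_simps forms_in_def is_ideal_def)

lemma linop_vec_mult: "linop (vec_mult n x)"
  unfolding linop_def vec_mult_def
  by (auto simp: linop_add[OF linop_create] linop_smul[OF linop_create] smul_add sum.distrib smul_sum mult.commute
      intro!: forms_in_sum forms_in_smul linop_forms_in[OF linop_create])

text \<open>Removing the smaller of two indices flips the sign attached to the larger one, and not
  conversely; the two orders therefore differ by exactly one sign.\<close>

lemma create_anticomm: "create i (create j f) = smul (-1) (create j (create i f))"
proof (cases "i = j")
  case True
  thus ?thesis by (simp add: create_def form_eq_iff)
next
  case False
  have "coef (create i (create j f)) S = coef (smul (-1) (create j (create i f))) S" for S
    using False
    by (cases "i < j") (auto simp: create_def below_sign_remove Diff_insert2[symmetric] insert_commute)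
  thus ?thesis by (simp add: form_eq_iff)
qed

text \<open>Stated on its own because anticommutation only yields that twice this form
  vanishes.\<close>

lemma create_square: "create i (create i f) = 0"
  by (simp add: create_def form_eq_iff)

text \<open>For equal indices exactly one of the two compositions sees a given S, according to
  whether i lies in S, and its two signs cancel. For different indices the sign comes from the
  smaller index being inserted or removed below the larger one.\<close>

lemma annih_create: "annih i (create j f) = (if i = j then f else 0) - create j (annih i f)"
proof (cases "i = j")
  case True
  have "coef (annih i (create i f)) S + coef (create i (annih i f)) S = coef f S" for S
    by (auto simp: annih_def create_def below_sign_insert below_sign_remove insert_absorb mult.assoc[symmetric] below_sign_square)
  thus ?thesis using True by (auto simp: form_eq_iff algebra_simps)
next
  case False
  have "coef (annih i (create j f)) S = - coef (create j (annih i f)) S" for S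
  proof (cases "i \<notin> S \<and> j \<in> S")
    case True
    hence "insert i S - {j} = insert i (S - {j})" using False by auto
    thus ?thesis using True False
      by (cases "i < j") (auto simp: annih_def create_def below_sign_remove below_sign_insert)
  next
    case F: False
    thus ?thesis using False by (auto simp: annih_def create_def)
  qed
  thus ?thesis using False by (simp add: form_eq_iff)
qed

lemma vec_mult_create: "vec_mult n x (create i f) = smul (-1) (create i (vec_mult n x f))"
  by (simp add: vec_mult_def linop_sum[OF linop_create] linop_smul[OF linop_create] create_anticomm[of _ i] smul_sum
      mult.commute)

lemma vec_mult_anticomm: "vec_mult n x (vec_mult n y f) = smul (-1) (vec_mult n y (vec_mult n x f))"
proof -
  have "vec_mult n x (vec_mult n y f) = (\<Sum>i\<in>{1..n}. smul (y i) (vec_mult n x (create i f)))"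
    by (subst (2) vec_mult_def) (simp add: linop_sum[OF linop_vec_mult] linop_smul[OF linop_vec_mult])
  also have "\<dots> = smul (-1) (vec_mult n y (vec_mult n x f))"
    by (simp add: vec_mult_create vec_mult_def[of n y] smul_sum mult.commute)
  finally show ?thesis .
qed

lemma vec_mult_Suc: "vec_mult (Suc n) x f = vec_mult n x f + smul (x (Suc n)) (create (Suc n) f)"
  by (simp add: vec_mult_def)

text \<open>Induction on the number of coordinates avoids dividing by 2: the square of the new term
  is zero and the two cross terms cancel by anticommutation.\<close>

lemma vec_mult_square: "vec_mult n x (vec_mult n x f) = 0"
proof (induction n)
  case 0
  show ?case by (simp add: vec_mult_def)
next
  case (Suc n)
  have "smul (x (Suc n)) g + smul (- x (Suc n)) g = 0" for g :: "'a form"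
    by (simp flip: smul_add_left)
  with Suc show ?case
    by (simp only: vec_mult_Suc linop_add[OF linop_vec_mult] linop_smul[OF linop_vec_mult] linop_add[OF linop_create]
        linop_smul[OF linop_create] smul_add vec_mult_create create_square smul_smul smul_zero) simp
qed

text \<open>Contraction is an antiderivation. The index must be in range, since
  \<open>vec_mult\<close> ignores all other coordinates of x.\<close>

lemma annih_vec_mult:
  assumes "i \<in> {1..n}"
  shows "annih i (vec_mult n x f) = smul (x i) f - vec_mult n x (annih i f)"
proof -
  have "annih i (vec_mult n x f) = (\<Sum>j\<in>{1..n}. smul (x j) (if i = j then f else 0)) - vec_mult n x (annih i f)"
    by (simp add: vec_mult_def linop_sum[OF linop_annih] linop_smul[OF linop_annih] annih_create smul_diff sum_subtractf)
  also have "(\<Sum>j\<in>{1..n}. smul (x j) (if i = j then f else 0)) = smul (x i) f"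
  proof -
    have "smul (x j) (if i = j then f else 0) = (if i = j then smul (x j) f else 0)" for j
      by simp
    thus ?thesis using assms by simp
  qed
  finally show ?thesis .
qed

text \<open>Projection to one degree. Integer degrees let coefficients of negative degree be treated
  uniformly as zero; the finiteness test keeps infinite sets, whose \<open>card\<close> is 0, out of
  degree 0.\<close>

definition homog :: "int \<Rightarrow> 'a::comm_ring_1 form \<Rightarrow> 'a form" where
  "homog d f = Form (\<lambda>S. if finite S \<and> int (card S) = d then coef f S else 0)"

lemma linop_homog: "linop (homog d)"
  unfolding linop_def
  by (auto simp: homog_def form_eq_iff algebra_simps forms_in_def is_ideal_def)

lemma homog_idem [simp]: "homog d (homog d f) = homog d f"
  by (auto simp: homog_def form_eq_iff)

lemma homog_negative: "d < 0 \<Longrightarrow> homog d f = 0"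
  by (auto simp: homog_def form_eq_iff)

lemma homog_create: "homog d (create i f) = create i (homog (d - 1) f)"
proof -
  have "int (card S) = d \<longleftrightarrow> int (card (S - {i})) = d - 1" if "finite S" "i \<in> S" for S
    using card_Suc_Diff1[OF that] by linarith
  thus ?thesis by (auto simp: homog_def create_def form_eq_iff)
qed

lemma homog_vec_mult: "homog d (vec_mult n x f) = vec_mult n x (homog (d - 1) f)"
  by (simp add: vec_mult_def linop_sum[OF linop_homog] linop_smul[OF linop_homog] homog_create)

definition vac :: "'a::comm_ring_1 form" where
  "vac = Form (\<lambda>S. if S = {} then 1 else 0)"

text \<open>Each contraction shifts the reading position from a set to that set with one more index,
  at the cost of a sign. Distinctness guarantees that the inserted index is new, as otherwise the
  contraction would return zero there.\<close>

lemma fold_annih_empty: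
  assumes "distinct is"
  shows "\<exists>\<epsilon>. \<epsilon> * \<epsilon> = 1 \<and> coef (fold annih is f) {} = \<epsilon> * coef f (set is)"
  using assms
proof (induction "is" arbitrary: f)
  case Nil
  show ?case by (auto intro: exI[of _ 1])
next
  case (Cons i "is")
  obtain \<epsilon> where e: "\<epsilon> * \<epsilon> = 1" "coef (fold annih is (annih i f)) {} = \<epsilon> * coef (annih i f) (set is)"
    using Cons by auto
  have "(\<epsilon> * below_sign i (set is)) * (\<epsilon> * below_sign i (set is)) = (\<epsilon> * \<epsilon>) * (below_sign i (set is) * below_sign i (set is))"
    by (simp only: ac_simps)
  moreover have "coef (fold annih (i # is) f) {} = \<epsilon> * below_sign i (set is) * coef f (set (i # is))"
    using e(2) Cons.prems by (simp add: annih_def[of i f] mult.assoc)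
  ultimately show ?case using e(1)
    by (intro exI[of _ "\<epsilon> * below_sign i (set is)"]) (simp add: below_sign_square)
qed

section \<open>Ideals and regular sequences\<close>

definition adjoin :: "'a::comm_ring_1 set \<Rightarrow> 'a \<Rightarrow> 'a set" where
  "adjoin q a = {x + b * a |x b. x \<in> q}"

lemma adjoinI: "x \<in> q \<Longrightarrow> x + b * a \<in> adjoin q a"
  by (auto simp: adjoin_def)

lemma is_ideal_adjoin:
  assumes "is_ideal q" shows "is_ideal (adjoin q a)"
  unfolding is_ideal_def
proof (intro conjI ballI allI)
  show "0 \<in> adjoin q a" using adjoinI[of 0 q 0 a] assms by (simp add: is_ideal_def)
next
  fix x y assume "x \<in> adjoin q a" "y \<in> adjoin q a"
  then obtain x' b y' c where "x = x' + b * a" "y = y' + c * a" "x' \<in> q" "y' \<in> q"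
    by (auto simp: adjoin_def)
  thus "x + y \<in> adjoin q a" using adjoinI[of "x' + y'" q "b + c" a] assms
    by (simp add: is_ideal_def algebra_simps)
next
  fix x y assume "y \<in> adjoin q a"
  then obtain y' c where "y = y' + c * a" "y' \<in> q"
    by (auto simp: adjoin_def)
  thus "x * y \<in> adjoin q a" using adjoinI[of "x * y'" q "x * c" a] assms
    by (simp add: is_ideal_def algebra_simps)
qed

lemma subset_adjoin: "q \<subseteq> adjoin q a"
  using adjoinI[of _ q 0 a] by auto

lemma forms_in_mono: "q \<subseteq> q' \<Longrightarrow> forms_in q \<subseteq> forms_in q'"
  by (auto simp: forms_in_def)

text \<open>Division by a modulo q: the multiplier is chosen separately for each coefficient, which
  is legitimate because any function on sets is a form.\<close>

lemma forms_in_adjE: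
  assumes "f \<in> forms_in (adjoin q a)"
  obtains z where "f - smul a z \<in> forms_in q"
proof -
  have "\<forall>S. \<exists>b. coef f S - a * b \<in> q"
  proof
    fix S
    have "coef f S \<in> adjoin q a" using assms by (simp add: forms_in_def)
    then obtain x b where "coef f S = x + b * a" "x \<in> q" by (auto simp: adjoin_def)
    thus "\<exists>b. coef f S - a * b \<in> q" by (auto intro!: exI[of _ b] simp: mult.commute)
  qed
  then obtain z where "\<forall>S. coef f S - a * z S \<in> q" by metis
  thus ?thesis by (intro that[of "Form z"]) (simp add: forms_in_def)
qed

lemma smul_in_forms_in_adjoin: "is_ideal q \<Longrightarrow> smul a f \<in> forms_in (adjoin q a)"
  using adjoinI[of 0 q _ a] by (auto simp: forms_in_def is_ideal_def mult.commute[of a])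

lemma ring_of_type_algebra_simps [simp]:
  "carrier ring_of_type_algebra = UNIV"
  "x \<otimes>\<^bsub>ring_of_type_algebra\<^esub> y = x * y"
  "x \<oplus>\<^bsub>ring_of_type_algebra\<^esub> y = x + y"
  "\<one>\<^bsub>ring_of_type_algebra\<^esub> = 1"
  "\<zero>\<^bsub>ring_of_type_algebra\<^esub> = 0"
  by (simp_all add: ring_of_type_algebra_def)

lemma ideal_ring_of_type_algebraI:
  fixes K :: "'b::ring_1 set"
  assumes "0 \<in> K" "\<And>x y. x \<in> K \<Longrightarrow> y \<in> K \<Longrightarrow> x + y \<in> K"
    "\<And>a x. x \<in> K \<Longrightarrow> a * x \<in> K" "\<And>a x. x \<in> K \<Longrightarrow> x * a \<in> K"
  shows "ideal K (ring_of_type_algebra :: 'b ring)"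
proof -
  interpret R: ring "ring_of_type_algebra :: 'b ring" by (rule ring_ring_of_type_algebra)
  have neg: "\<ominus>\<^bsub>ring_of_type_algebra\<^esub> x = - x" for x :: 'b
    by (rule R.minus_equality) simp_all
  show ?thesis
  proof (rule idealI[OF ring_ring_of_type_algebra])
    show "subgroup K (add_monoid (ring_of_type_algebra :: 'b ring))"
    proof (rule R.add.subgroupI)
      fix x assume "x \<in> K"
      thus "\<ominus>\<^bsub>ring_of_type_algebra\<^esub> x \<in> K" using assms(3)[of x "-1"] by (simp add: neg)
    qed (use assms in auto)
  qed (use assms in auto)
qed

lemma is_ideal_imp_ideal: "is_ideal q \<Longrightarrow> ideal q ring_of_type_algebra"
  by (rule ideal_ring_of_type_algebraI) (auto simp: is_ideal_def mult.commute)

lemma is_ideal_genideal: "is_ideal (genideal ring_of_type_algebra S)"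
proof -
  interpret ideal "genideal ring_of_type_algebra S" "ring_of_type_algebra :: 'a::comm_ring_1 ring"
    by (rule ring.genideal_ideal[OF ring_ring_of_type_algebra]) simp
  show ?thesis
    using additive_subgroup.zero_closed[OF additive_subgroup_axioms]
      additive_subgroup.a_closed[OF additive_subgroup_axioms] I_l_closed
    by (simp add: is_ideal_def)
qed

lemma genideal_subset_is_ideal: "is_ideal q \<Longrightarrow> S \<subseteq> q \<Longrightarrow> genideal ring_of_type_algebra S \<subseteq> q"
  by (rule ring.genideal_minimal[OF ring_ring_of_type_algebra is_ideal_imp_ideal])

lemma subset_genideal: "S \<subseteq> genideal ring_of_type_algebra S"
  by (auto simp: genideal_def)

lemma genideal_empty: "genideal (ring_of_type_algebra :: 'a::comm_ring_1 ring) {} = {0}"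
  using genideal_subset_is_ideal[OF is_ideal_zero, of "{}"] is_ideal_genideal[of "{}"]
  by (auto simp: is_ideal_def)

lemma adjoin_genideal:
  "adjoin (genideal ring_of_type_algebra S) x = genideal ring_of_type_algebra (insert x S)"
proof
  show "adjoin (genideal ring_of_type_algebra S) x \<subseteq> genideal ring_of_type_algebra (insert x S)"
  proof
    fix y assume "y \<in> adjoin (genideal ring_of_type_algebra S) x"
    then obtain z b where y: "y = z + b * x" "z \<in> genideal ring_of_type_algebra S"
      by (auto simp: adjoin_def)
    have "genideal ring_of_type_algebra S \<subseteq> genideal ring_of_type_algebra (insert x S)"
      using subset_genideal by (intro genideal_subset_is_ideal is_ideal_genideal) blast
    moreover have "x \<in> genideal ring_of_type_algebra (insert x S)"
      using subset_genideal by blast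
    ultimately show "y \<in> genideal ring_of_type_algebra (insert x S)"
      using is_ideal_genideal y unfolding is_ideal_def by blast
  qed
  show "genideal ring_of_type_algebra (insert x S) \<subseteq> adjoin (genideal ring_of_type_algebra S) x"
  proof (rule genideal_subset_is_ideal)
    have "0 \<in> genideal ring_of_type_algebra S" using is_ideal_genideal by (auto simp: is_ideal_def)
    hence "x \<in> adjoin (genideal ring_of_type_algebra S) x" using adjoinI[of 0 _ 1 x] by auto
    thus "insert x S \<subseteq> adjoin (genideal ring_of_type_algebra S) x"
      using subset_adjoin subset_genideal by fast
  qed (intro is_ideal_adjoin is_ideal_genideal)
qed

text \<open>Weak regularity of the sequence on the quotient by q. The recursion peels off the first
  element and enlarges q, which is the shape of the induction in
  \<open>de_Rham_mod_regular\<close>.\<close>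

fun regular_mod :: "'a::comm_ring_1 set \<Rightarrow> 'a list \<Rightarrow> bool" where
  "regular_mod q [] \<longleftrightarrow> True"
| "regular_mod q (x # xs) \<longleftrightarrow> (\<forall>b. x * b \<in> q \<longrightarrow> b \<in> q) \<and> regular_mod (adjoin q x) xs"

text \<open>The list \<open>ys\<close> holds the elements already adjoined; generalising over it
  turns the indexed definition of regularity into the recursive one.\<close>

lemma regular_mod_of_regular_sequence:
  assumes "\<And>i a. i < length zs \<Longrightarrow>
      a * zs ! i \<in> genideal ring_of_type_algebra (set ys \<union> set (take i zs)) \<Longrightarrow>
      a \<in> genideal ring_of_type_algebra (set ys \<union> set (take i zs))"
  shows "regular_mod (genideal ring_of_type_algebra (set ys)) zs"
  using assms
proof (induction zs arbitrary: ys)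
  case (Cons z zs)
  have "regular_mod (genideal ring_of_type_algebra (set (z # ys))) zs"
    using Cons.prems[of "Suc _"] by (intro Cons.IH) simp
  moreover have "\<forall>b. z * b \<in> genideal ring_of_type_algebra (set ys) \<longrightarrow>
      b \<in> genideal ring_of_type_algebra (set ys)"
    using Cons.prems[of 0] by (simp add: mult.commute)
  ultimately show ?case by (simp add: adjoin_genideal)
qed simp

section \<open>Products of a family of vectors\<close>

definition word_mult :: "nat \<Rightarrow> (nat \<Rightarrow> 'a::comm_ring_1) list \<Rightarrow> 'a form \<Rightarrow> 'a form" where
  "word_mult n = foldr (vec_mult n)"

lemma word_mult_simps [simp]: "word_mult n [] f = f" "word_mult n (x # xs) f = vec_mult n x (word_mult n xs f)"
  by (simp_all add: word_mult_def)

lemma word_mult_append: "word_mult n (xs @ ys) f = word_mult n xs (word_mult n ys f)"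
  by (simp add: word_mult_def)

lemma linop_word_mult: "linop (word_mult n xs)"
  unfolding word_mult_def by (rule linop_foldr) (rule linop_vec_mult)

lemma homog_word_mult: "homog d (word_mult n xs f) = word_mult n xs (homog (d - int (length xs)) f)"
  by (induction xs arbitrary: d) (simp_all add: homog_vec_mult algebra_simps)

lemma word_mult_move: "word_mult n (xs @ y # ys) f = smul ((-1) ^ length xs) (word_mult n (y # xs @ ys) f)"
  by (induction xs) (auto simp: linop_smul[OF linop_vec_mult] vec_mult_anticomm[of n _ y])

text \<open>The sign is chosen before f, so one sign serves for all forms. Its actual value, the
  parity of a permutation, never matters.\<close>

lemma word_mult_mset:
  assumes "mset xs = mset ys"
  shows "\<exists>\<epsilon>. \<epsilon> * \<epsilon> = 1 \<and> (\<forall>f. word_mult n xs f = smul \<epsilon> (word_mult n ys f))"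
  using assms
proof (induction xs arbitrary: ys)
  case Nil
  thus ?case by (auto intro: exI[of _ 1])
next
  case (Cons x xs)
  then obtain as bs where ys: "ys = as @ x # bs"
    by (metis list.set_intros(1) mset_eq_setD split_list)
  obtain \<epsilon> where e: "\<epsilon> * \<epsilon> = 1" "\<And>f. word_mult n xs f = smul \<epsilon> (word_mult n (as @ bs) f)"
    using Cons.IH[of "as @ bs"] Cons.prems ys by auto
  define \<delta> :: 'a where "\<delta> = (-1) ^ length as"
  have d: "\<delta> * \<delta> = 1" by (simp add: \<delta>_def flip: power_mult_distrib)
  have "smul \<delta> (word_mult n ys f) = word_mult n (x # as @ bs) f" for f
    unfolding ys word_mult_move by (simp add: d flip: \<delta>_def)
  hence "word_mult n (x # xs) f = smul (\<epsilon> * \<delta>) (word_mult n ys f)" for f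
    by (simp add: e linop_smul[OF linop_vec_mult] flip: smul_smul)
  moreover have "(\<epsilon> * \<delta>) * (\<epsilon> * \<delta>) = (\<epsilon> * \<epsilon>) * (\<delta> * \<delta>)" by (simp only: ac_simps)
  ultimately show ?case using e(1) d by (intro exI[of _ "\<epsilon> * \<delta>"]) simp
qed

lemma word_mult_repeated: "word_mult n (xs @ x # ys @ x # zs) f = 0"
proof -
  have "word_mult n (x # ys @ x # zs) f = 0"
    using word_mult_move[of n ys x zs f] by (simp add: linop_smul[OF linop_vec_mult] vec_mult_square)
  thus ?thesis by (simp only: word_mult_append linop_zero[OF linop_word_mult])
qed

text \<open>The Leibniz rule for an antiderivation: contraction deletes each factor in turn, and the
  last term is the one where it passes all factors.\<close>

lemma word_mult_contract:
  assumes "i \<in> {1..n}"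
  shows "annih i (word_mult n xs f) =
    (\<Sum>j<length xs. smul ((-1) ^ j * (xs ! j) i) (word_mult n (take j xs @ drop (Suc j) xs) f))
    + smul ((-1) ^ length xs) (word_mult n xs (annih i f))"
proof (induction xs)
  case (Cons x xs)
  show ?case
    by (simp add: annih_vec_mult[OF assms] Cons.IH sum.lessThan_Suc_shift linop_sum[OF linop_vec_mult]
        linop_smul[OF linop_vec_mult] linop_add[OF linop_vec_mult] diff_eq_smul smul_add smul_sum del: sum.lessThan_Suc)
qed simp

section \<open>The modules of combinations of t-fold products, modulo an ideal\<close>

locale vectors =
  fixes n r :: nat and w :: "nat \<Rightarrow> nat \<Rightarrow> 'a::comm_ring_1"
begin

abbreviation wlist :: "nat list \<Rightarrow> 'a form \<Rightarrow> 'a form" where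
  "wlist js \<equiv> word_mult n (map w js)"

abbreviation wJ :: "nat set \<Rightarrow> 'a form \<Rightarrow> 'a form" where
  "wJ J \<equiv> wlist (sorted_list_of_set J)"

abbreviation subsets :: "nat \<Rightarrow> nat set set" where
  "subsets t \<equiv> {J. J \<subseteq> {1..r} \<and> card J = t}"

lemma finite_subsets [simp]: "finite (subsets t)"
  by (rule finite_subset[of _ "Pow {1..r}"]) auto

lemma wlist_set:
  assumes "distinct js"
  shows "\<exists>\<epsilon>. \<epsilon> * \<epsilon> = 1 \<and> (\<forall>f. wlist js f = smul \<epsilon> (wJ (set js) f))"
proof (rule word_mult_mset)
  have "mset js = mset (sorted_list_of_set (set js))"
    using assms by (subst set_eq_iff_mset_eq_distinct[symmetric]) auto
  thus "mset (map w js) = mset (map w (sorted_list_of_set (set js)))" by (simp only: mset_map)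
qed

lemma wlist_not_distinct: "\<not> distinct js \<Longrightarrow> wlist js f = 0"
proof -
  assume "\<not> distinct js"
  then obtain xs y ys zs where "js = xs @ [y] @ ys @ [y] @ zs"
    using not_distinct_decomp by blast
  thus ?thesis using word_mult_repeated[of n "map w xs" "w y" "map w ys" "map w zs" f] by simp
qed

lemma wJ_wJ_disjoint:
  assumes "finite J" "finite K" "J \<inter> K = {}"
  shows "\<exists>\<epsilon>. \<epsilon> * \<epsilon> = 1 \<and> (\<forall>f. wJ J (wJ K f) = smul \<epsilon> (wJ (J \<union> K) f))"
  using wlist_set[of "sorted_list_of_set J @ sorted_list_of_set K"] assms by (simp add: word_mult_append)

lemma wJ_wJ_meet:
  assumes "finite J" "finite K" "J \<inter> K \<noteq> {}"
  shows "wJ J (wJ K f) = 0"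
  using wlist_not_distinct[of "sorted_list_of_set J @ sorted_list_of_set K" f] assms
  by (simp add: word_mult_append)

text \<open>This is the preimage of the module of t-fold combinations over the quotient by q,
  described without forming that quotient.\<close>

definition W :: "nat \<Rightarrow> 'a set \<Rightarrow> 'a form set" where
  "W t q = {f. \<exists>g. f - (\<Sum>J\<in>subsets t. wJ J (g J)) \<in> forms_in q}"

lemma WI: "f - (\<Sum>J\<in>subsets t. wJ J (g J)) \<in> forms_in q \<Longrightarrow> f \<in> W t q"
  by (auto simp: W_def)

lemma W_add:
  assumes "is_ideal q" "f \<in> W t q" "f' \<in> W t q"
  shows "f + f' \<in> W t q"
proof -
  obtain g g' where "f - (\<Sum>J\<in>subsets t. wJ J (g J)) \<in> forms_in q" "f' - (\<Sum>J\<in>subsets t. wJ J (g' J)) \<in> forms_in q"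
    using assms by (auto simp: W_def)
  from forms_in_add[OF assms(1) this]
  have "(f + f') - (\<Sum>J\<in>subsets t. wJ J (g J + g' J)) \<in> forms_in q"
    by (simp add: linop_add[OF linop_word_mult] sum.distrib algebra_simps)
  thus ?thesis by (rule WI)
qed

lemma W_smul:
  assumes "is_ideal q" "f \<in> W t q"
  shows "smul a f \<in> W t q"
proof -
  obtain g where "f - (\<Sum>J\<in>subsets t. wJ J (g J)) \<in> forms_in q"
    using assms by (auto simp: W_def)
  from forms_in_smul[OF assms(1) this, of a]
  have "smul a f - (\<Sum>J\<in>subsets t. wJ J (smul a (g J))) \<in> forms_in q"
    by (simp add: linop_smul[OF linop_word_mult] smul_diff smul_sum)
  thus ?thesis by (rule WI)
qed

lemma W_forms_in: "is_ideal q \<Longrightarrow> f \<in> forms_in q \<Longrightarrow> f \<in> W t q"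
  by (rule WI[where g = "\<lambda>_. 0"]) (simp add: linop_zero[OF linop_word_mult])

lemma W_sum: "is_ideal q \<Longrightarrow> (\<And>x. x \<in> A \<Longrightarrow> f x \<in> W t q) \<Longrightarrow> sum f A \<in> W t q"
  by (induction A rule: infinite_finite_induct) (auto simp: W_add W_forms_in forms_in_0)

lemma W_mono: "q \<subseteq> q' \<Longrightarrow> W t q \<subseteq> W t q'"
  unfolding W_def using forms_in_mono[of q q'] by blast

lemma W_plus_forms_in:
  assumes "is_ideal q" "g \<in> W t q" "f - g \<in> forms_in q"
  shows "f \<in> W t q"
  using W_add[OF assms(1,2) W_forms_in[OF assms(1,3)]] by simp

lemma W_0: "is_ideal q \<Longrightarrow> f \<in> W 0 q"
proof -
  assume q: "is_ideal q"
  have "J = {}" if "J \<in> subsets 0" for J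
    using that finite_subset[of J "{1..r}"] by simp
  hence "subsets 0 = {{}}" by auto
  thus ?thesis using q by (intro WI[where g = "\<lambda>_. f"]) (simp add: forms_in_0)
qed

lemma wJ_in_W:
  assumes "is_ideal q" "J \<in> subsets t"
  shows "wJ J f \<in> W t q"
proof -
  have "(\<Sum>K\<in>subsets t. wJ K (if K = J then f else 0)) = (\<Sum>K\<in>subsets t. if K = J then wJ K f else 0)"
    by (intro sum.cong) (auto simp: linop_zero[OF linop_word_mult])
  also have "\<dots> = wJ J f" using assms(2) by (subst sum.delta) auto
  finally show ?thesis
    using assms(1) by (intro WI[where g = "\<lambda>K. if K = J then f else 0"]) (simp add: forms_in_0)
qed

lemma wlist_in_W:
  assumes "is_ideal q" "set js \<subseteq> {1..r}"
  shows "wlist js f \<in> W (length js) q"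
proof (cases "distinct js")
  case True
  then obtain \<epsilon> where "\<And>f. wlist js f = smul \<epsilon> (wJ (set js) f)" using wlist_set by blast
  moreover have "set js \<in> subsets (length js)" using True assms by (simp add: distinct_card)
  ultimately show ?thesis using assms(1) by (simp add: W_smul wJ_in_W)
next
  case False
  thus ?thesis using assms(1) by (simp add: wlist_not_distinct W_forms_in forms_in_0)
qed

lemma wJ_W:
  assumes "is_ideal q" "f \<in> W t q" "J \<in> subsets s"
  shows "wJ J f \<in> W (s + t) q"
proof -
  obtain g where g: "f - (\<Sum>K\<in>subsets t. wJ K (g K)) \<in> forms_in q"
    using assms by (auto simp: W_def)
  have "wJ J (wJ K (g K)) \<in> W (s + t) q" if "K \<in> subsets t" for K
    using wlist_in_W[OF assms(1), of "sorted_list_of_set J @ sorted_list_of_set K"] that assms(3)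
      finite_subset[of J "{1..r}"] finite_subset[of K "{1..r}"]
    by (auto simp: word_mult_append)
  hence "(\<Sum>K\<in>subsets t. wJ J (wJ K (g K))) \<in> W (s + t) q"
    by (intro W_sum assms(1))
  moreover have "wJ J f - (\<Sum>K\<in>subsets t. wJ J (wJ K (g K))) \<in> forms_in q"
    using linop_forms_in[OF linop_word_mult assms(1) g]
    by (simp add: linop_diff[OF linop_word_mult] linop_sum[OF linop_word_mult])
  ultimately show ?thesis by (rule W_plus_forms_in[OF assms(1)])
qed

text \<open>The last factor of each product is absorbed into its coefficient.\<close>

lemma W_Suc_subset:
  assumes "is_ideal q" "f \<in> W (Suc t) q"
  shows "f \<in> W t q"
proof -
  obtain g where g: "f - (\<Sum>K\<in>subsets (Suc t). wJ K (g K)) \<in> forms_in q"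
    using assms by (auto simp: W_def)
  have "wJ K (g K) \<in> W t q" if "K \<in> subsets (Suc t)" for K
  proof -
    have fin: "finite K" and K: "K \<subseteq> {1..r}" "card K = Suc t"
      using that finite_subset[of K "{1..r}"] by auto
    define js where "js = sorted_list_of_set K"
    have js: "set js = K" "length js = Suc t" using fin K by (simp_all add: js_def)
    have "js = butlast js @ [last js]" using js by (intro append_butlast_last_id[symmetric]) auto
    hence "wlist js (g K) = wlist (butlast js) (wlist [last js] (g K))"
      by (metis word_mult_append map_append)
    moreover have "set (butlast js) \<subseteq> {1..r}" using in_set_butlastD[of _ js] js K by auto
    ultimately show ?thesis
      using wlist_in_W[OF assms(1), of "butlast js" "wlist [last js] (g K)"] js(2) by (simp add: js_def)
  qed
  hence "(\<Sum>K\<in>subsets (Suc t). wJ K (g K)) \<in> W t q"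
    by (intro W_sum assms(1))
  thus ?thesis using g by (rule W_plus_forms_in[OF assms(1)])
qed

text \<open>Projecting every coefficient to degree d - t keeps the decomposition valid because f is
  homogeneous. Degree control on the coefficients is what lets an induction hypothesis apply to
  them.\<close>

lemma W_homogeneous:
  assumes "is_ideal q" "f \<in> W t q" "homog d f = f"
  shows "\<exists>g. (\<forall>J. homog (d - int t) (g J) = g J) \<and> f - (\<Sum>J\<in>subsets t. wJ J (g J)) \<in> forms_in q"
proof -
  obtain g where g: "f - (\<Sum>J\<in>subsets t. wJ J (g J)) \<in> forms_in q"
    using assms by (auto simp: W_def)
  have "homog d (\<Sum>J\<in>subsets t. wJ J (g J)) = (\<Sum>J\<in>subsets t. wJ J (homog (d - int t) (g J)))"
    unfolding linop_sum[OF linop_homog] homog_word_mult by (intro sum.cong) auto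
  hence "f - (\<Sum>J\<in>subsets t. wJ J (homog (d - int t) (g J))) \<in> forms_in q"
    using linop_forms_in[OF linop_homog assms(1) g, of d] assms(3) by (simp add: linop_diff[OF linop_homog])
  thus ?thesis by (intro exI[of _ "\<lambda>J. homog (d - int t) (g J)"]) simp
qed

lemma homog_W:
  assumes "is_ideal q" "f \<in> W t q"
  shows "homog d f \<in> W t q"
proof -
  obtain g where g: "f - (\<Sum>J\<in>subsets t. wJ J (g J)) \<in> forms_in q"
    using assms by (auto simp: W_def)
  have "homog d (\<Sum>J\<in>subsets t. wJ J (g J)) = (\<Sum>J\<in>subsets t. wJ J (homog (d - int t) (g J)))"
    unfolding linop_sum[OF linop_homog] homog_word_mult by (intro sum.cong) auto
  hence "homog d f - (\<Sum>J\<in>subsets t. wJ J (homog (d - int t) (g J))) \<in> forms_in q"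
    using linop_forms_in[OF linop_homog assms(1) g, of d] by (simp add: linop_diff[OF linop_homog])
  thus ?thesis by (rule WI)
qed

lemma W_adjoin:
  assumes "is_ideal q" "f \<in> W t (adjoin q a)"
  shows "\<exists>z. f - smul a z \<in> W t q"
proof -
  obtain g where g: "f - (\<Sum>J\<in>subsets t. wJ J (g J)) \<in> forms_in (adjoin q a)"
    using assms by (auto simp: W_def)
  then obtain z where "f - (\<Sum>J\<in>subsets t. wJ J (g J)) - smul a z \<in> forms_in q"
    by (rule forms_in_adjE)
  hence "(f - smul a z) - (\<Sum>J\<in>subsets t. wJ J (g J)) \<in> forms_in q"
    by (simp add: algebra_simps)
  thus ?thesis by (intro exI[of _ z] WI)
qed

text \<open>Multiply the decomposition by the product over the complement K of J. Any other index
  set of size t meets K, so its term has a repeated factor and vanishes; the term of J becomes the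
  full product up to sign.\<close>

lemma coefficient_annihilated:
  assumes "is_ideal q" "f - (\<Sum>J\<in>subsets t. wJ J (g J)) \<in> forms_in q" "t \<le> r"
    "\<And>K. K \<in> subsets (r - t) \<Longrightarrow> wJ K f \<in> forms_in q" "J \<in> subsets t"
  shows "wJ {1..r} (g J) \<in> forms_in q"
proof -
  define K where "K = {1..r} - J"
  have J: "J \<subseteq> {1..r}" "card J = t" "finite J"
    using assms(5) finite_subset[of J "{1..r}"] by auto
  have K: "K \<in> subsets (r - t)" "finite K"
    using J by (auto simp: K_def card_Diff_subset)
  have KJ: "K \<inter> J = {}" "K \<union> J = {1..r}" using J by (auto simp: K_def)
  have "wJ K (wJ L (g L)) = 0" if "L \<in> subsets t - {J}" for L
  proof (rule wJ_wJ_meet)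
    show "finite L" using that finite_subset[of L "{1..r}"] by auto
    show "K \<inter> L \<noteq> {}"
    proof
      assume "K \<inter> L = {}"
      hence "L \<subseteq> J" using that by (auto simp: K_def)
      hence "L = J" using that J by (intro card_subset_eq) auto
      thus False using that by simp
    qed
  qed (use K in simp)
  hence "wJ K (\<Sum>L\<in>subsets t. wJ L (g L)) = wJ K (wJ J (g J))"
    using assms(5) unfolding linop_sum[OF linop_word_mult] by (subst sum.remove[of _ J]) auto
  moreover obtain \<epsilon> where e: "\<epsilon> * \<epsilon> = 1" "wJ K (wJ J (g J)) = smul \<epsilon> (wJ {1..r} (g J))"
    using wJ_wJ_disjoint[OF K(2) J(3) KJ(1)] KJ(2) by auto
  moreover have "wJ K (f - (\<Sum>L\<in>subsets t. wJ L (g L))) \<in> forms_in q"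
    by (rule linop_forms_in[OF linop_word_mult assms(1,2)])
  ultimately have "wJ K f - smul \<epsilon> (wJ {1..r} (g J)) \<in> forms_in q"
    by (simp add: linop_diff[OF linop_word_mult])
  from forms_in_diff[OF assms(1) assms(4)[OF K(1)] this]
  have "smul \<epsilon> (wJ {1..r} (g J)) \<in> forms_in q" by simp
  thus ?thesis using e(1) by (rule forms_in_smul_unit[OF assms(1)])
qed

text \<open>Every contraction either deletes a vector or moves on to f. A term that keeps a vector
  in front lies in \<open>W 1 {0}\<close>, so only terms where all vectors were deleted leave a
  scalar multiple of f. The vanishing clause for short contraction lists is part of the induction:
  it disposes of the term that spends a contraction on f.\<close>

lemma contraction_scalar_mod_W1:
  assumes "set is \<subseteq> {1..n}" "set js \<subseteq> {1..r}" "length is \<le> length js"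
  shows "\<exists>c. (length is < length js \<longrightarrow> c = 0) \<and> (\<forall>f. fold annih is (wlist js f) - smul c f \<in> W 1 {0})"
  using assms
proof (induction "is" arbitrary: js)
  case Nil
  show ?case
  proof (cases js)
    case Nil
    thus ?thesis by (intro exI[of _ 1]) (simp add: W_forms_in is_ideal_zero)
  next
    case (Cons j js')
    thus ?thesis using wlist_in_W[OF is_ideal_zero, of "[j]"] Nil.prems by (intro exI[of _ 0]) simp
  qed
next
  case (Cons i "is")
  define del where "del k = take k js @ drop (Suc k) js" for k
  have "\<exists>c. (length is < length js - 1 \<longrightarrow> c = 0) \<and>
      (\<forall>f. fold annih is (wlist (del k) f) - smul c f \<in> W 1 {0})" if "k < length js" for k
  proof -
    have "length (del k) = length js - 1" using that by (simp add: del_def)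
    moreover have "set (del k) \<subseteq> {1..r}"
      using set_take_subset[of k js] set_drop_subset[of "Suc k" js] Cons.prems by (auto simp: del_def)
    ultimately show ?thesis using Cons.IH[of "del k"] Cons.prems by auto
  qed
  then obtain c where c: "\<And>k. k < length js \<Longrightarrow> length is < length js - 1 \<Longrightarrow> c k = 0"
    "\<And>k f. k < length js \<Longrightarrow> fold annih is (wlist (del k) f) - smul (c k) f \<in> W 1 {0}"
    by metis
  \<comment> \<open>The word with nothing deleted now has more factors than contractions remain, so
    the induction hypothesis gives the scalar zero.\<close>
  obtain d where d: "d = 0" "\<And>f. fold annih is (wlist js f) - smul d f \<in> W 1 {0}"
    using Cons.IH[of js] Cons.prems by auto
  define a where "a k = (-1) ^ k * w (js ! k) i" for k
  define b where "b = (\<Sum>k<length js. a k * c k)"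
  have lin: "linop (fold annih is)" by (rule linop_fold) (rule linop_annih)
  have "fold annih (i # is) (wlist js f) - smul b f \<in> W 1 {0}" for f
  proof -
    have eq: "annih i (wlist js f) = (\<Sum>k<length js. smul (a k) (wlist (del k) f))
        + smul ((-1) ^ length js) (wlist js (annih i f))"
      using word_mult_contract[of i n "map w js" f] Cons.prems
      by (simp add: a_def del_def take_map drop_map)
    have "smul b f = (\<Sum>k<length js. smul (a k) (smul (c k) f))"
      by (auto simp: form_eq_iff b_def coef_sum sum_distrib_right mult.assoc)
    hence "fold annih (i # is) (wlist js f) - smul b f =
        (\<Sum>k<length js. smul (a k) (fold annih is (wlist (del k) f) - smul (c k) f))
        + smul ((-1) ^ length js) (fold annih is (wlist js (annih i f)))"
      by (simp add: eq linop_add[OF lin] linop_sum[OF lin] linop_smul[OF lin] smul_diff sum_subtractf)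
    moreover have "fold annih is (wlist js (annih i f)) \<in> W 1 {0}" using d by simp
    ultimately show ?thesis
      using c(2) by (simp only:) (intro W_add W_sum W_smul is_ideal_zero; simp)
  qed
  moreover have "b = 0" if "length (i # is) < length js"
    using c(1) that by (simp add: b_def)
  ultimately show ?case by blast
qed

text \<open>A product with a vector has no component in degree 0. This is used to identify the
  scalar of \<open>contraction_scalar_mod_W1\<close>.\<close>

lemma W1_empty: "f \<in> W 1 {0} \<Longrightarrow> coef f {} = 0"
proof -
  assume "f \<in> W 1 {0}"
  then obtain g where g: "f = (\<Sum>J\<in>subsets 1. wJ J (g J))"
    by (auto simp: W_def)
  have "coef (wJ J (g J)) {} = 0" if "J \<in> subsets 1" for J
  proof -
    from that have "card J = 1" by simp
    then obtain j where "J = {j}" by (rule card_1_singletonE)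
    thus ?thesis by (simp add: vec_mult_def coef_sum create_def)
  qed
  thus ?thesis by (simp add: g coef_sum)
qed

end

section \<open>Multiplication by the ideal of minors and cancellation along regular
  sequences\<close>

locale vectors_minors = vectors n r w for n r and w :: "nat \<Rightarrow> nat \<Rightarrow> 'a::comm_ring_1" +
  fixes c :: "nat set \<Rightarrow> 'a" and I :: "'a set"
  assumes minors: "\<And>S. S \<subseteq> {1..n} \<Longrightarrow> card S = r \<Longrightarrow> coef (wJ {1..r} vac) S = c S"
    and I_minimal: "\<And>q. is_ideal q \<Longrightarrow> (\<And>S. S \<subseteq> {1..n} \<Longrightarrow> card S = r \<Longrightarrow> c S \<in> q) \<Longrightarrow> I \<subseteq> q"
begin

lemma minor_mult_in_W1:
  assumes "is_ideal q" "wJ {1..r} f \<in> forms_in q" "S \<subseteq> {1..n}" "card S = r"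
  shows "smul (c S) f \<in> W 1 q"
proof -
  define "is" where "is = sorted_list_of_set S"
  have S: "finite S" using assms(3) finite_subset by auto
  have is_S: "set is = S" "distinct is" "length is = r" using S assms(4) by (simp_all add: is_def)
  obtain d where d: "\<And>f. fold annih is (wJ {1..r} f) - smul d f \<in> W 1 {0}"
    using contraction_scalar_mod_W1[of "is" "sorted_list_of_set {1..r}"] is_S assms(3) by auto
  obtain \<epsilon> where e: "\<epsilon> * \<epsilon> = 1"
    "coef (fold annih is (wJ {1..r} vac)) {} = \<epsilon> * coef (wJ {1..r} vac) (set is)"
    using fold_annih_empty[OF is_S(2)] by blast
  \<comment> \<open>The scalar d does not depend on the form, so it can be read off at
    \<open>vac\<close>, where the contraction yields the minor up to sign.\<close>
  have "d = \<epsilon> * c S"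
    using W1_empty[OF d[of vac]] e(2) minors[OF assms(3,4)] by (simp add: is_S vac_def)
  hence cS: "c S = \<epsilon> * d" using e(1) by (simp flip: mult.assoc)
  have lin: "linop (fold annih is)" by (rule linop_fold) (rule linop_annih)
  have "fold annih is (wJ {1..r} f) - smul d f \<in> W 1 q"
    using d W_mono[of "{0}" q] assms(1) by (auto simp: is_ideal_def)
  moreover have "fold annih is (wJ {1..r} f) \<in> W 1 q"
    by (intro W_forms_in linop_forms_in[OF lin] assms)
  ultimately have "smul (-1) (fold annih is (wJ {1..r} f) - smul d f) + fold annih is (wJ {1..r} f) \<in> W 1 q"
    by (intro W_add W_smul assms(1))
  moreover have "smul (-1) (fold annih is (wJ {1..r} f) - smul d f) + fold annih is (wJ {1..r} f) = smul d f"
    by (simp only: form_eq_iff coef_simps coef_smul) simp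
  ultimately have "smul d f \<in> W 1 q" by simp
  from W_smul[OF assms(1) this, of \<epsilon>] show ?thesis by (simp add: cS)
qed

text \<open>The scalars that move f into \<open>W 1 q\<close> form an ideal containing the minors,
  hence containing I by minimality.\<close>

lemma ideal_mult_in_W1:
  assumes "is_ideal q" "wJ {1..r} f \<in> forms_in q" "g \<in> I"
  shows "smul g f \<in> W 1 q"
proof -
  have "is_ideal {g. smul g f \<in> W 1 q}"
    unfolding is_ideal_def using W_smul[OF assms(1)]
    by (auto simp: smul_add_left W_add assms(1) W_forms_in forms_in_0 simp flip: smul_smul)
  from I_minimal[OF this] show ?thesis using minor_mult_in_W1[OF assms(1,2)] assms(3) by blast
qed

text \<open>Since p + s is at most r, any K of size r - p contains a set of size s, so the product
  over K kills f. Hence the full product kills the coefficients, and h moves each of them into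
  \<open>W 1 {0}\<close>, gaining one more factor.\<close>

lemma ideal_mult_step:
  assumes "\<And>K. K \<in> subsets s \<Longrightarrow> wJ K f = 0" "p + s \<le> r" "smul g f \<in> W p {0}" "h \<in> I"
  shows "smul (h * g) f \<in> W (Suc p) {0}"
proof -
  obtain \<beta> where b: "smul g f - (\<Sum>J\<in>subsets p. wJ J (\<beta> J)) \<in> forms_in {0}"
    using assms(3) unfolding W_def by blast
  have "wJ K (smul g f) \<in> forms_in {0}" if K: "K \<in> subsets (r - p)" for K
  proof -
    have "s \<le> card K" using K assms(2) by auto
    then obtain L where L: "L \<subseteq> K" "card L = s" using obtain_subset_with_card_n by metis
    have fin: "finite K" "finite L" using K L finite_subset[of _ "{1..r}"] by auto
    obtain \<epsilon> where e: "\<epsilon> * \<epsilon> = 1" "wJ (K - L) (wJ L f) = smul \<epsilon> (wJ K f)"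
      using wJ_wJ_disjoint[of "K - L" L] fin L by (auto simp: Un_absorb2)
    have "wJ L f = 0" using assms(1)[of L] L K by auto
    hence "smul \<epsilon> (wJ K f) \<in> forms_in {0}" using e(2) by (simp add: linop_zero[OF linop_word_mult])
    hence "wJ K f \<in> forms_in {0}" using forms_in_smul_unit[OF is_ideal_zero _ e(1)] by blast
    thus ?thesis by (simp add: linop_smul[OF linop_word_mult])
  qed
  hence "wJ {1..r} (\<beta> J) \<in> forms_in {0}" if "J \<in> subsets p" for J
    using coefficient_annihilated[OF is_ideal_zero b] assms(2) that by auto
  hence "smul h (\<beta> J) \<in> W 1 {0}" if "J \<in> subsets p" for J
    using ideal_mult_in_W1[OF is_ideal_zero _ assms(4)] that by blast
  hence "(\<Sum>J\<in>subsets p. wJ J (smul h (\<beta> J))) \<in> W (p + 1) {0}"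
    by (intro W_sum is_ideal_zero wJ_W)
  moreover have "smul (h * g) f - (\<Sum>J\<in>subsets p. wJ J (smul h (\<beta> J))) \<in> forms_in {0}"
    using forms_in_smul[OF is_ideal_zero b, of h] by (simp add: linop_smul[OF linop_word_mult] smul_diff smul_sum)
  ultimately show ?thesis using W_plus_forms_in[OF is_ideal_zero] by simp
qed

text \<open>The bound is one larger than in \<open>ideal_mult_step\<close>, because the final step
  starts from p = r - s and ends at r - s + 1.\<close>

lemma ideal_element_power:
  assumes "\<And>K. K \<in> subsets s \<Longrightarrow> wJ K f = 0" "p + s \<le> Suc r" "x \<in> I"
  shows "smul (x ^ p) f \<in> W p {0}"
  using assms(2)
proof (induction p)
  case 0
  show ?case by (rule W_0[OF is_ideal_zero])
next
  case (Suc p)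
  hence "smul (x ^ p) f \<in> W p {0}" by simp
  from ideal_mult_step[OF assms(1) _ this assms(3)] show ?case using Suc.prems by simp
qed

text \<open>The hypothesis on \<open>g\<close> is the case \<open>t = 1\<close> of the theorem modulo the larger ideal; negative degrees
  \<open>l\<close> and \<open>D \<le> 0\<close> are allowed, which makes the case \<open>d < t\<close> unexceptional.\<close>

lemma W_cancel:
  assumes "is_ideal q" and nzd: "\<And>b. a * b \<in> q \<Longrightarrow> b \<in> q"
    and IH: "\<And>g l. l < D \<Longrightarrow> homog l g = g \<Longrightarrow> wJ {1..r} g \<in> forms_in (adjoin q a) \<Longrightarrow> g \<in> W 1 (adjoin q a)"
    and "d < D + int t" "homog d f = f" "smul a f \<in> W t q"
  shows "f \<in> W t q"
  using assms(4-6)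
proof (induction "Suc r - t" arbitrary: t f)
  case 0
  \<comment> \<open>Here t exceeds r, so membership in \<open>W t q\<close> just means coefficients
    in q, and a is cancelled coefficient by coefficient.\<close>
  have "subsets t = {}"
  proof (rule equals0I)
    fix J assume J: "J \<in> subsets t"
    hence "card J \<le> card {1..r}" by (intro card_mono) auto
    thus False using J 0 by simp
  qed
  with 0(4) have "smul a f \<in> forms_in q" unfolding W_def by (simp only: sum.empty) simp
  hence "a * coef f S \<in> q" for S by (simp add: forms_in_def)
  hence "coef f S \<in> q" for S using nzd[of "coef f S"] by simp
  hence "f \<in> forms_in q" by (simp add: forms_in_def)
  thus ?case by (rule W_forms_in[OF assms(1)])
next
  case (Suc m)
  have tr: "t \<le> r" using Suc.hyps(2) by simp
  have prs: "homog d (smul a f) = smul a f" using Suc.prems by (simp add: linop_smul[OF linop_homog])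
  obtain g where g: "\<And>J. homog (d - int t) (g J) = g J" "smul a f - (\<Sum>J\<in>subsets t. wJ J (g J)) \<in> forms_in q"
    using W_homogeneous[OF assms(1) Suc.prems(3) prs] by blast
  have q': "is_ideal (adjoin q a)" by (rule is_ideal_adjoin[OF assms(1)])
  have "\<exists>z. g J - smul a z \<in> W 1 q" if J: "J \<in> subsets t" for J
  proof -
    \<comment> \<open>Modulo the larger ideal the form being decomposed is zero, so every product
      kills it and the coefficient lemma applies.\<close>
    have "wJ {1..r} (g J) \<in> forms_in (adjoin q a)"
    proof (rule coefficient_annihilated[OF q' _ tr _ J])
      show "smul a f - (\<Sum>J\<in>subsets t. wJ J (g J)) \<in> forms_in (adjoin q a)"
        using g(2) forms_in_mono[OF subset_adjoin] by blast
      show "wJ K (smul a f) \<in> forms_in (adjoin q a)" for K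
        by (intro linop_forms_in[OF linop_word_mult] q' smul_in_forms_in_adjoin assms(1))
    qed
    hence "g J \<in> W 1 (adjoin q a)" using IH[OF _ g(1)] Suc.prems(1) by simp
    thus ?thesis by (rule W_adjoin[OF assms(1)])
  qed
  then obtain z where z: "\<And>J. J \<in> subsets t \<Longrightarrow> g J - smul a (z J) \<in> W 1 q" by metis
  \<comment> \<open>The multipliers obtained by choice need not be homogeneous; projecting them to
    degree d - t keeps the corrected form in degree d.\<close>
  define z' where "z' J = homog (d - int t) (z J)" for J
  have z': "g J - smul a (z' J) \<in> W 1 q" if "J \<in> subsets t" for J
    using homog_W[OF assms(1) z[OF that], of "d - int t"] g(1)
    by (simp add: z'_def linop_diff[OF linop_homog] linop_smul[OF linop_homog])
  define f' where "f' = f - (\<Sum>J\<in>subsets t. wJ J (z' J))"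
  have "(\<Sum>J\<in>subsets t. wJ J (g J - smul a (z' J))) \<in> W (t + 1) q"
    by (intro W_sum assms(1) wJ_W z')
  moreover have "smul a f' - (\<Sum>J\<in>subsets t. wJ J (g J - smul a (z' J))) \<in> forms_in q"
    using g(2) by (simp add: f'_def smul_diff smul_sum linop_diff[OF linop_word_mult] linop_smul[OF linop_word_mult] sum_subtractf)
  ultimately have "smul a f' \<in> W (t + 1) q" by (rule W_plus_forms_in[OF assms(1)])
  moreover have "homog d f' = f'"
  proof -
    have "homog d (wJ J (z' J)) = wJ J (z' J)" if "J \<in> subsets t" for J
      using that by (simp add: homog_word_mult z'_def)
    thus ?thesis using Suc.prems(2)
      by (simp add: f'_def linop_diff[OF linop_homog] linop_sum[OF linop_homog])
  qed
  ultimately have "f' \<in> W (t + 1) q"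
    using Suc.hyps(1)[of "t + 1" f'] Suc.hyps(2) Suc.prems(1) by simp
  hence "f' \<in> W t q" using W_Suc_subset[OF assms(1)] by simp
  moreover have "(\<Sum>J\<in>subsets t. wJ J (z' J)) \<in> W t q"
    by (intro W_sum assms(1) wJ_in_W)
  ultimately have "f' + (\<Sum>J\<in>subsets t. wJ J (z' J)) \<in> W t q" by (rule W_add[OF assms(1)])
  thus ?case by (simp add: f'_def)
qed

text \<open>Induction on the sequence. With no elements the degree is negative and the form is zero.
  Otherwise the first element moves f into \<open>W 1 q\<close> because it lies in I, and
  \<open>W_cancel\<close> removes it, using the remaining elements modulo the first.\<close>

lemma de_Rham_mod_regular:
  assumes "is_ideal q" "regular_mod q xs" "set xs \<subseteq> I" "d < int (length xs)" "homog d f = f"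
    "wJ {1..r} f \<in> forms_in q"
  shows "f \<in> W 1 q"
  using assms
proof (induction xs arbitrary: q d f)
  case Nil
  hence "f = 0" using homog_negative[of d f] by simp
  thus ?case using Nil by (simp add: W_forms_in forms_in_0)
next
  case (Cons x xs)
  have "smul x f \<in> W 1 q" using ideal_mult_in_W1 Cons.prems by simp
  moreover have "g \<in> W 1 (adjoin q x)"
    if "l < int (length xs)" "homog l g = g" "wJ {1..r} g \<in> forms_in (adjoin q x)" for g l
    using Cons.IH[OF is_ideal_adjoin] Cons.prems that by auto
  ultimately show ?case
    using W_cancel[of q x "int (length xs)" d 1 f] Cons.prems by auto
qed

text \<open>Only the first element x is cancelled here; the other elements enter through
  \<open>de_Rham_mod_regular\<close> modulo x. The non-strict degree bound counts \<open>xs\<close>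
  alone, hence is strict in terms of the whole sequence.\<close>

lemma generalized_de_Rham:
  assumes "regular_mod {0} (x # xs)" "set (x # xs) \<subseteq> I"
    "\<And>K. K \<in> subsets s \<Longrightarrow> wJ K f = 0" "s \<le> r"
    "d \<le> int (length xs) + int (r - s)" "homog d f = f"
  shows "f \<in> W (r - s + 1) {0}"
proof -
  have cancel: "g \<in> W (r - s + 1) {0}" if "smul x g \<in> W (r - s + 1) {0}" "homog d g = g" for g
  proof (rule W_cancel[OF is_ideal_zero _ _ _ that(2,1)])
    show "d < int (length xs) + int (r - s + 1)" using assms(5) by simp
    show "h \<in> W 1 (adjoin {0} x)"
      if "l < int (length xs)" "homog l h = h" "wJ {1..r} h \<in> forms_in (adjoin {0} x)" for h l
      using de_Rham_mod_regular[OF is_ideal_adjoin[OF is_ideal_zero]] assms(1,2) that by auto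
  qed (use assms(1) in simp)
  \<comment> \<open>The power of x is stripped one factor at a time, each intermediate multiple
    still being homogeneous of degree d.\<close>
  have "smul (x ^ p) f \<in> W (r - s + 1) {0} \<Longrightarrow> f \<in> W (r - s + 1) {0}" for p
  proof (induction p)
    case (Suc p)
    thus ?case using cancel[of "smul (x ^ p) f"] assms(6) by (simp add: linop_smul[OF linop_homog])
  qed simp
  moreover have "smul (x ^ (r - s + 1)) f \<in> W (r - s + 1) {0}"
    using assms(2,4) by (intro ideal_element_power[OF assms(3)]) auto
  ultimately show ?thesis by blast
qed

text \<open>Elements of a power of I are sums of products; each product is handled by
  \<open>ideal_mult_step\<close>, and sums stay in the module.\<close>

lemma ideal_power_mult:
  assumes "\<And>K. K \<in> subsets s \<Longrightarrow> wJ K f = 0" "p + s \<le> Suc r"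
    "g \<in> I [^]\<^bsub>ideals_set ring_of_type_algebra\<^esub> p"
  shows "smul g f \<in> W p {0}"
  using assms(2,3)
proof (induction p arbitrary: g)
  case 0
  show ?case by (rule W_0[OF is_ideal_zero])
next
  case (Suc p)
  define P where "P = I [^]\<^bsub>ideals_set ring_of_type_algebra\<^esub> p"
  have "g \<in> ideal_prod ring_of_type_algebra P I"
    using Suc.prems by (simp add: P_def nat_pow_def ideals_set_def)
  thus ?case
  proof induction
    case (prod i j)
    have "smul i f \<in> W p {0}" using Suc prod by (simp add: P_def)
    from ideal_mult_step[OF assms(1) _ this prod(2)] show ?case
      using Suc.prems(1) by (simp add: mult.commute)
  next
    case (sum a b)
    thus ?case by (simp add: smul_add_left W_add is_ideal_zero)
  qed
qed

end

section \<open>Comparison with the exterior algebra\<close>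

lemma free_alg_induct [case_names zero single add]:
  fixes u :: "('a::comm_ring_1, 'm) free_alg"
  assumes "P 0" "\<And>xs a. P (Poly_Mapping.single (Word xs) a)" "\<And>u v. P u \<Longrightarrow> P v \<Longrightarrow> P (u + v)"
  shows "P u"
proof (induction u rule: update_induct)
  case const
  show ?case by (rule assms(1))
next
  case (update u k a)
  have "Poly_Mapping.update k a u = Poly_Mapping.single k a + u"
    using update(1)
    by (intro poly_mapping_eqI)
      (auto simp: lookup_update lookup_add lookup_single in_keys_iff when_def)
  thus ?case using assms(2)[of "letters k" a] assms(3) update by simp
qed

lemma pure_tensor_mult: "pure_tensor xs * pure_tensor ys = pure_tensor (xs @ ys)"
  by (simp add: mult_single plus_free_monoid_def)

lemma pure_tensor_Nil: "pure_tensor [] = 1"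
  by (simp flip: zero_free_monoid_def)

lemma scalar_central: "u * scalar a = scalar a * u" for u :: "('a::comm_ring_1, 'm) free_alg"
  by (induction u rule: free_alg_induct) (auto simp: mult_single algebra_simps)

section \<open>The action of the free algebra on forms\<close>

locale free_module = M: Modules.module scale
  for scale :: "'a::comm_ring_1 \<Rightarrow> 'm::ab_group_add \<Rightarrow> 'm" +
  fixes e :: "nat \<Rightarrow> 'm" and n :: nat
  assumes inj: "inj_on e {1..n}"
    and independent: "Modules.module.independent scale (e ` {1..n})"
    and spanning: "Modules.module.span scale (e ` {1..n}) = UNIV"
begin

definition coord :: "'m \<Rightarrow> nat \<Rightarrow> 'a" where
  "coord x i = M.representation (e ` {1..n}) x (e i)"

lemma in_span: "x \<in> M.span (e ` {1..n})"
  by (simp only: spanning UNIV_I)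

lemma coord_add: "coord (x + y) i = coord x i + coord y i"
  by (simp only: coord_def M.representation_add[OF independent in_span in_span])

lemma coord_scale: "coord (scale a x) i = a * coord x i"
  by (simp only: coord_def M.representation_scale[OF independent in_span])

lemma coord_basis: "i \<in> {1..n} \<Longrightarrow> j \<in> {1..n} \<Longrightarrow> coord (e i) j = (if j = i then 1 else 0)"
  using M.representation_basis[OF independent, of "e i"] inj
  by (simp add: coord_def inj_on_eq_iff)

lemma sum_coord: "(\<Sum>i\<in>{1..n}. scale (coord x i) (e i)) = x"
  using M.sum_representation_eq[OF independent in_span, of "e ` {1..n}" x] inj
  by (simp add: sum.reindex coord_def)

lemma vec_mult_coord_add: "vec_mult n (coord (x + y)) f = vec_mult n (coord x) f + vec_mult n (coord y) f"
  by (simp add: vec_mult_def coord_add smul_add_left sum.distrib)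

lemma vec_mult_coord_scale: "vec_mult n (coord (scale a x)) f = smul a (vec_mult n (coord x) f)"
  by (simp add: vec_mult_def coord_scale smul_sum)

lemma vec_mult_coord_basis:
  assumes "i \<in> {1..n}" shows "vec_mult n (coord (e i)) f = create i f"
proof -
  have "vec_mult n (coord (e i)) f = (\<Sum>j\<in>{1..n}. if j = i then create j f else 0)"
    unfolding vec_mult_def using assms by (intro sum.cong) (auto simp: coord_basis)
  thus ?thesis using assms by simp
qed

abbreviation word_act :: "'m list \<Rightarrow> 'a form \<Rightarrow> 'a form" where
  "word_act xs \<equiv> word_mult n (map coord xs)"

text \<open>Letters act as left multiplications by vectors, so \<open>act u vac\<close> is the form
  represented by u.\<close>

definition act :: "('a, 'm) free_alg \<Rightarrow> 'a form \<Rightarrow> 'a form" where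
  "act u f = (\<Sum>v\<in>Poly_Mapping.keys u. smul (Poly_Mapping.lookup u v) (word_act (letters v) f))"

lemma act_zero [simp]: "act 0 f = 0"
  by (simp add: act_def)

lemma act_single [simp]: "act (Poly_Mapping.single v a) f = smul a (word_act (letters v) f)"
  by (simp add: act_def)

lemma act_add: "act (u + v) f = act u f + act v f"
  unfolding act_def by (rule setsum_keys_plus_distrib) (simp_all add: smul_add_left)

lemma act_sum: "act (\<Sum>i\<in>A. g i) f = (\<Sum>i\<in>A. act (g i) f)"
  by (induction A rule: infinite_finite_induct) (auto simp: act_add)

lemma act_diff: "act (u - v) f = act u f - act v f"
  using act_add[of "u - v" v f] by (simp add: eq_diff_eq)

lemma linop_act: "linop (act u)"
  unfolding linop_def act_def
  by (auto simp: linop_add[OF linop_word_mult] linop_smul[OF linop_word_mult] smul_add sum.distrib smul_sum mult.commute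
      intro!: forms_in_sum forms_in_smul linop_forms_in[OF linop_word_mult])

lemma act_mult: "act (u * v) f = act u (act v f)"
proof (induction u rule: free_alg_induct)
  case (single xs a)
  show ?case
  proof (induction v rule: free_alg_induct)
    case (single ys b)
    show ?case
      by (simp add: mult_single plus_free_monoid_def word_mult_append linop_smul[OF linop_word_mult])
  qed (simp_all add: algebra_simps act_add linop_add[OF linop_word_mult] linop_zero[OF linop_word_mult] smul_add)
qed (simp_all add: algebra_simps act_add)

text \<open>The elements acting as zero form a two-sided ideal containing the defining relations, so
  the action factors through the exterior algebra.\<close>

lemma act_ext_ideal:
  assumes "u \<in> ext_ideal scale" shows "act u f = 0"
proof -
  have "ext_ideal scale \<subseteq> {u. \<forall>f. act u f = 0}"
    unfolding ext_ideal_def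
  proof (rule ring.genideal_minimal[OF ring_ring_of_type_algebra])
    show "ideal {u. \<forall>f. act u f = 0} (ring_of_type_algebra :: ('a, 'm) free_alg ring)"
      by (rule ideal_ring_of_type_algebraI) (auto simp: act_add act_mult linop_zero[OF linop_act])
    show "ext_relations scale \<subseteq> {u. \<forall>f. act u f = 0}"
      by (auto simp: ext_relations_def act_diff act_add act_mult vec_mult_coord_add vec_mult_coord_scale vec_mult_square
          zero_free_monoid_def)
  qed
  thus ?thesis using assms by blast
qed

lemma homog_act:
  assumes "\<And>v. v \<in> Poly_Mapping.keys u \<Longrightarrow> length (letters v) = k"
  shows "homog (int k) (act u vac) = act u vac"
proof -
  have  "homog 0 vac = (vac :: 'a form)" by (auto simp: homog_def vac_def form_eq_iff)
  thus ?thesis using assms unfolding act_def linop_sum[OF linop_homog]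
    by (intro sum.cong) (simp_all add: linop_smul[OF linop_homog] homog_word_mult)
qed

section \<open>Congruence modulo the defining ideal of the exterior algebra\<close>

definition cong :: "('a, 'm) free_alg \<Rightarrow> ('a, 'm) free_alg \<Rightarrow> bool" (infix "\<doteq>" 50) where
  "u \<doteq> v \<longleftrightarrow> u - v \<in> ext_ideal scale"

lemma ext_ideal_closed:
  "0 \<in> ext_ideal scale"
  "u \<in> ext_ideal scale \<Longrightarrow> v \<in> ext_ideal scale \<Longrightarrow> u + v \<in> ext_ideal scale"
  "u \<in> ext_ideal scale \<Longrightarrow> v * u \<in> ext_ideal scale"
  "u \<in> ext_ideal scale \<Longrightarrow> u * v \<in> ext_ideal scale"
proof -
  interpret ideal "ext_ideal scale" "ring_of_type_algebra :: ('a, 'm) free_alg ring"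
    by (rule ideal_ext_ideal)
  show "0 \<in> ext_ideal scale"
    "u \<in> ext_ideal scale \<Longrightarrow> v \<in> ext_ideal scale \<Longrightarrow> u + v \<in> ext_ideal scale"
    "u \<in> ext_ideal scale \<Longrightarrow> v * u \<in> ext_ideal scale"
    "u \<in> ext_ideal scale \<Longrightarrow> u * v \<in> ext_ideal scale"
    using additive_subgroup.zero_closed[OF additive_subgroup_axioms]
      additive_subgroup.a_closed[OF additive_subgroup_axioms, of u v] I_l_closed[of u v] I_r_closed[of u v] by simp_all
qed

lemma cong_refl [simp]: "u \<doteq> u"
  by (simp add: cong_def ext_ideal_closed)

lemma cong_sym: "u \<doteq> v \<Longrightarrow> v \<doteq> u"
  using ext_ideal_closed(3)[of "u - v" "-1"] by (simp add: cong_def)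

lemma cong_trans [trans]: "u \<doteq> v \<Longrightarrow> v \<doteq> t \<Longrightarrow> u \<doteq> t"
  using ext_ideal_closed(2)[of "u - v" "v - t"] by (simp add: cong_def)

lemma cong_add: "u \<doteq> v \<Longrightarrow> u' \<doteq> v' \<Longrightarrow> u + u' \<doteq> v + v'"
  using ext_ideal_closed(2)[of "u - v" "u' - v'"] by (simp add: cong_def algebra_simps)

lemma cong_mult: "u \<doteq> v \<Longrightarrow> u' \<doteq> v' \<Longrightarrow> u * u' \<doteq> v * v'"
  using ext_ideal_closed(2)[OF ext_ideal_closed(4)[of "u - v" u'] ext_ideal_closed(3)[of "u' - v'" v]]
  by (simp add: cong_def algebra_simps)

lemma cong_sum: "(\<And>x. x \<in> A \<Longrightarrow> g x \<doteq> h x) \<Longrightarrow> sum g A \<doteq> sum h A"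
  by (induction A rule: infinite_finite_induct) (auto intro: cong_add)

lemma cong_act: "u \<doteq> v \<Longrightarrow> act u f = act v f"
  using act_ext_ideal[of "u - v" f] by (simp add: cong_def act_diff)

lemma ext_relations_subset: "ext_relations scale \<subseteq> ext_ideal scale"
  by (auto simp: ext_ideal_def genideal_def)

lemma cong_vector_add: "pure_tensor [x + y] \<doteq> pure_tensor [x] + pure_tensor [y]"
  unfolding cong_def by (rule subsetD[OF ext_relations_subset]) (auto simp: ext_relations_def)

lemma cong_vector_scale: "pure_tensor [scale a x] \<doteq> scalar a * pure_tensor [x]"
  unfolding cong_def by (rule subsetD[OF ext_relations_subset]) (auto simp: ext_relations_def)

lemma cong_vector_square: "pure_tensor [x] * pure_tensor [x] \<doteq> 0"
proof -
  have "pure_tensor [x] * pure_tensor [x] \<in> ext_ideal scale"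
    by (rule subsetD[OF ext_relations_subset]) (auto simp: ext_relations_def)
  thus ?thesis by (simp add: cong_def)
qed

lemma cong_vector_zero: "pure_tensor [0] \<doteq> 0"
  using cong_vector_scale[of 0 0] by simp

lemma cong_vector_sum: "pure_tensor [\<Sum>i\<in>A. x i] \<doteq> (\<Sum>i\<in>A. pure_tensor [x i])"
proof (induction A rule: infinite_finite_induct)
  case (insert i A)
  have "pure_tensor [\<Sum>i\<in>insert i A. x i] \<doteq> pure_tensor [x i] + pure_tensor [\<Sum>i\<in>A. x i]"
    using insert cong_vector_add by simp
  also have "\<dots> \<doteq> pure_tensor [x i] + (\<Sum>i\<in>A. pure_tensor [x i])"
    by (intro cong_add insert) simp
  finally show ?case using insert by simp
qed (simp_all add: cong_vector_zero)

lemma cong_vector: "pure_tensor [x] \<doteq> (\<Sum>i\<in>{1..n}. scalar (coord x i) * pure_tensor [e i])"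
proof -
  have "pure_tensor [x] \<doteq> (\<Sum>i\<in>{1..n}. pure_tensor [scale (coord x i) (e i)])"
    using cong_vector_sum[of "\<lambda>i. scale (coord x i) (e i)" "{1..n}"] by (simp only: sum_coord)
  also have "\<dots> \<doteq> (\<Sum>i\<in>{1..n}. scalar (coord x i) * pure_tensor [e i])"
    by (intro cong_sum cong_vector_scale)
  finally show ?thesis .
qed

text \<open>Polarisation: expand the vanishing square of x + y and drop the squares of x and
  y.\<close>

lemma cong_vector_swap:
  "pure_tensor (x # y # xs) \<doteq> scalar (-1) * pure_tensor (y # x # xs)"
proof -
  have "0 \<doteq> pure_tensor [x + y] * pure_tensor [x + y]"
    by (rule cong_sym[OF cong_vector_square])
  also have "\<dots> \<doteq> (pure_tensor [x] + pure_tensor [y]) * (pure_tensor [x] + pure_tensor [y])"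
    by (intro cong_mult cong_vector_add)
  also have "\<dots> = (pure_tensor [x] * pure_tensor [x] + pure_tensor [y] * pure_tensor [y])
      + (pure_tensor [x] * pure_tensor [y] + pure_tensor [y] * pure_tensor [x])"
    by (simp only: algebra_simps)
  also have "\<dots> \<doteq> (0 + 0) + (pure_tensor [x] * pure_tensor [y] + pure_tensor [y] * pure_tensor [x])"
    by (intro cong_add cong_vector_square cong_refl)
  finally have "pure_tensor [x] * pure_tensor [y] + pure_tensor [y] * pure_tensor [x] \<doteq> 0"
    by (simp add: cong_sym)
  from cong_mult[OF this cong_refl[of "pure_tensor xs"]]
  have "pure_tensor (x # y # xs) + pure_tensor (y # x # xs) \<doteq> 0"
    by (simp add: algebra_simps pure_tensor_mult mult.assoc)
  thus ?thesis by (simp add: cong_def mult_single single_uminus)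
qed

lemma cong_Cons: "pure_tensor xs \<doteq> u \<Longrightarrow> pure_tensor (x # xs) \<doteq> pure_tensor [x] * u"
  using cong_mult[OF cong_refl[of "pure_tensor [x]"], of "pure_tensor xs" u]
  by (simp add: pure_tensor_mult)

text \<open>The leading letter is swapped to the right until it meets its copy, where the square
  relation applies.\<close>

lemma cong_repeated: "x \<in> set xs \<Longrightarrow> pure_tensor (x # xs) \<doteq> 0"
proof (induction xs)
  case (Cons y ys)
  show ?case
  proof (cases "x = y")
    case True
    have "pure_tensor [x] * pure_tensor [x] * pure_tensor ys \<doteq> 0 * pure_tensor ys"
      by (intro cong_mult cong_vector_square cong_refl)
    thus ?thesis using True by (simp add: pure_tensor_mult)
  next
    case False
    have "pure_tensor (x # y # ys) \<doteq> scalar (-1) * pure_tensor (y # x # ys)"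
      by (rule cong_vector_swap)
    also have "\<dots> \<doteq> scalar (-1) * (pure_tensor [y] * 0)"
      using Cons False by (intro cong_mult cong_refl cong_Cons) auto
    finally show ?thesis by simp
  qed
qed simp

text \<open>Moving \<open>e i\<close> to its sorted place passes exactly the smaller indices, one
  sign each, which is what \<open>below_sign\<close> counts.\<close>

lemma cong_insort:
  assumes "sorted xs" "distinct xs" "i \<notin> set xs"
  shows "pure_tensor (map e (i # xs)) \<doteq> scalar (below_sign i (set xs)) * pure_tensor (map e (insort i xs))"
  using assms
proof (induction xs)
  case Nil
  show ?case by (simp add: below_sign_def mult_single)
next
  case (Cons x xs)
  show ?case
  proof (cases "i < x")
    case True
    hence "below_sign i (set (x # xs)) = (1 :: 'a)" using Cons.prems by (intro below_sign_eq_1) auto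
    thus ?thesis using True by (simp add: mult_single)
  next
    case False
    hence xi: "x < i" using Cons.prems by auto
    have below_sign: "below_sign i (set (x # xs)) = - (below_sign i (set xs) :: 'a)"
      using below_sign_insert[of x "set xs" i] xi Cons.prems by simp
    have "pure_tensor (map e (i # x # xs)) \<doteq> scalar (-1) * pure_tensor (e x # map e (i # xs))"
      using cong_vector_swap[of "e i" "e x" "map e xs"] by simp
    also have "\<dots> \<doteq> scalar (-1) *
        (pure_tensor [e x] * (scalar (below_sign i (set xs)) * pure_tensor (map e (insort i xs))))"
      using Cons by (intro cong_mult cong_refl cong_Cons Cons.IH) auto
    also have "\<dots> = scalar (below_sign i (set (x # xs))) * pure_tensor (map e (insort i (x # xs)))"
      using xi by (simp add: mult_single below_sign plus_free_monoid_def zero_free_monoid_def del: set_simps)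
    finally show ?thesis .
  qed
qed

text \<open>A section of the action on the vacuum: \<open>embed\<close> intertwines left multiplications modulo the ideal
  defining the exterior algebra, so the latter is a direct summand of the forms.\<close>

definition embed :: "'a form \<Rightarrow> ('a, 'm) free_alg" where
  "embed f = (\<Sum>S\<in>Pow {1..n}. scalar (coef f S) * pure_tensor (map e (sorted_list_of_set S)))"

lemma embed_add: "embed (f + g) = embed f + embed g"
  by (simp add: embed_def single_add algebra_simps sum.distrib)

lemma embed_smul: "embed (smul a f) = scalar a * embed f"
  by (simp add: embed_def sum_distrib_left mult_single)

lemma embed_zero [simp]: "embed 0 = 0"
  by (simp add: embed_def)

lemma embed_sum: "embed (\<Sum>i\<in>A. g i) = (\<Sum>i\<in>A. embed (g i))"
  by (induction A rule: infinite_finite_induct) (auto simp: embed_add)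

lemma embed_vac: "embed vac = pure_tensor []"
proof -
  have "embed vac = (\<Sum>S\<in>Pow {1..n}. if S = {} then pure_tensor [] else 0)"
    unfolding embed_def by (intro sum.cong) (auto simp: vac_def mult_single)
  thus ?thesis by simp
qed

text \<open>Removing i matches the sets containing i with those avoiding it, and sorting the word
  that begins with \<open>e i\<close> produces the sign in \<open>create\<close>.\<close>

lemma embed_create:
  assumes "i \<in> {1..n}"
  shows "embed (create i f) \<doteq> pure_tensor [e i] * embed f"
proof -
  let ?p = "\<lambda>S. pure_tensor (map e (sorted_list_of_set S)) :: ('a, 'm) free_alg"
  let ?A = "{S. S \<subseteq> {1..n} \<and> i \<notin> S}"
  have fin: "finite S" if "S \<subseteq> {1..n}" for S :: "nat set"
    using that finite_subset by blast
  have bij: "bij_betw (insert i) ?A {S. S \<subseteq> {1..n} \<and> i \<in> S}"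
    by (rule bij_betwI[where g = "\<lambda>S. S - {i}"]) (use assms in auto)
  have "embed (create i f) = (\<Sum>S\<in>{S. S \<subseteq> {1..n} \<and> i \<in> S}. scalar (below_sign i S * coef f (S - {i})) * ?p S)"
    unfolding embed_def by (rule sum.mono_neutral_cong_right) (auto simp: create_def)
  also have "\<dots> = (\<Sum>S\<in>?A. scalar (below_sign i (insert i S) * coef f (insert i S - {i})) * ?p (insert i S))"
    by (rule sum.reindex_bij_betw[OF bij, symmetric])
  also have "\<dots> = (\<Sum>S\<in>?A. scalar (coef f S) * (scalar (below_sign i S) * ?p (insert i S)))"
    by (intro sum.cong) (auto simp: below_sign_insert mult_single mult.commute)
  also have "\<dots> \<doteq> (\<Sum>S\<in>?A. scalar (coef f S) * (pure_tensor [e i] * ?p S))"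
  proof (rule cong_sum, rule cong_mult[OF cong_refl])
    fix S assume S: "S \<in> ?A"
    hence "?p (insert i S) = pure_tensor (map e (insort i (sorted_list_of_set S)))"
      using fin[of S] by (simp add: sorted_list_of_set_insert_remove)
    thus "scalar (below_sign i S) * ?p (insert i S) \<doteq> pure_tensor [e i] * ?p S"
      using cong_sym[OF cong_insort[of "sorted_list_of_set S" i]] S fin[of S]
      by (simp add: pure_tensor_mult)
  qed
  also have "\<dots> = (\<Sum>S\<in>Pow {1..n}. if i \<notin> S then scalar (coef f S) * (pure_tensor [e i] * ?p S) else 0)"
    by (rule sum.mono_neutral_cong_left) auto
  \<comment> \<open>The sets containing i may be put back: their words repeat \<open>e i\<close> and
    are congruent to zero.\<close>
  also have "\<dots> \<doteq> (\<Sum>S\<in>Pow {1..n}. scalar (coef f S) * (pure_tensor [e i] * ?p S))"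
  proof (rule cong_sum)
    fix S assume S: "S \<in> Pow {1..n}"
    show "(if i \<notin> S then scalar (coef f S) * (pure_tensor [e i] * ?p S) else 0)
        \<doteq> scalar (coef f S) * (pure_tensor [e i] * ?p S)"
    proof (cases "i \<in> S")
      case True
      hence "pure_tensor [e i] * ?p S \<doteq> 0"
        using cong_repeated[of "e i" "map e (sorted_list_of_set S)"] S fin[of S]
        by (simp add: pure_tensor_mult)
      from cong_sym[OF cong_mult[OF cong_refl this]] show ?thesis using True by simp
    qed simp
  qed
  also have "\<dots> = pure_tensor [e i] * embed f"
    by (simp add: embed_def sum_distrib_left scalar_central flip: mult.assoc)
  finally show ?thesis .
qed

lemma embed_vec_mult: "embed (vec_mult n (coord x) f) \<doteq> pure_tensor [x] * embed f"
proof -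
  have "embed (vec_mult n (coord x) f) = (\<Sum>i\<in>{1..n}. scalar (coord x i) * embed (create i f))"
    by (simp add: vec_mult_def embed_sum embed_smul)
  also have "\<dots> \<doteq> (\<Sum>i\<in>{1..n}. scalar (coord x i) * (pure_tensor [e i] * embed f))"
    by (intro cong_sum cong_mult cong_refl embed_create)
  also have "\<dots> = (\<Sum>i\<in>{1..n}. scalar (coord x i) * pure_tensor [e i]) * embed f"
    by (simp add: sum_distrib_right mult.assoc)
  also have "\<dots> \<doteq> pure_tensor [x] * embed f"
    by (intro cong_mult cong_refl cong_sym[OF cong_vector])
  finally show ?thesis .
qed

lemma embed_word_mult: "embed (word_act xs f) \<doteq> pure_tensor xs * embed f"
proof (induction xs)
  case (Cons x xs)
  have "embed (word_act (x # xs) f) \<doteq> pure_tensor [x] * embed (word_act xs f)"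
    using embed_vec_mult by simp
  also have "\<dots> \<doteq> pure_tensor [x] * (pure_tensor xs * embed f)"
    by (intro cong_mult cong_refl Cons)
  finally show ?case by (simp add: pure_tensor_mult flip: mult.assoc)
qed (simp add: pure_tensor_Nil)

text \<open>Consequently the form \<open>act u vac\<close> determines the class of u, so identities
  between forms can be carried back to the exterior algebra.\<close>

lemma embed_act: "embed (act u vac) \<doteq> u"
proof (induction u rule: free_alg_induct)
  case (single xs a)
  have "scalar a * embed (word_act xs vac) \<doteq> scalar a * (pure_tensor xs * embed vac)"
    by (intro cong_mult cong_refl embed_word_mult)
  thus ?case
    by (simp add: embed_smul embed_vac pure_tensor_Nil mult_single)
qed (simp_all add: act_add embed_add cong_add)

lemma keys_embed:
  assumes "homog d f = f" "v \<in> Poly_Mapping.keys (embed f)"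
  shows "int (length (letters v)) = d"
proof -
  have "v \<in> (\<Union>S\<in>Pow {1..n}. Poly_Mapping.keys (scalar (coef f S) * pure_tensor (map e (sorted_list_of_set S))))"
    using assms(2) keys_sum unfolding embed_def by fast
  then obtain S where "coef f S \<noteq> 0" "v = Word (map e (sorted_list_of_set S))"
    by (auto simp: mult_single split: if_splits)
  moreover have "coef (homog d f) S \<noteq> 0" using calculation assms(1) by simp
  ultimately show ?thesis by (simp add: homog_def split: if_splits)
qed

text \<open>Each new letter has the smallest index, so no sign appears. Increasing basis words thus
  give the standard forms, which permits comparing coefficients.\<close>

lemma word_act_basis_vac:
  assumes "sorted xs" "distinct xs" "set xs \<subseteq> {1..n}"
  shows "coef (word_act (map e xs) vac) S = (if S = set xs then 1 else 0)"
  using assms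
proof (induction xs arbitrary: S)
  case (Cons x xs)
  have "below_sign x S = (1 :: 'a)" if "S = insert x (set xs)"
    using Cons.prems that by (intro below_sign_eq_1) auto
  moreover have "x \<in> S \<and> S - {x} = set xs \<longleftrightarrow> S = insert x (set xs)"
    using Cons.prems by auto
  ultimately show ?case using Cons by (auto simp: vec_mult_coord_basis create_def)
qed (simp add: vac_def)

section \<open>Transfer of decompositions to the exterior algebra\<close>

lemma ext_class_eq_iff: "ext_class scale u = ext_class scale v \<longleftrightarrow> u \<doteq> v"
proof
  assume "ext_class scale u = ext_class scale v"
  moreover have "0 + u \<in> ext_class scale u"
    using ext_ideal_closed(1) unfolding ext_class_def a_r_coset_def' by fastforce
  ultimately obtain x where "x \<in> ext_ideal scale" "u = x + v"
    unfolding ext_class_def a_r_coset_def' by auto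
  thus "u \<doteq> v" by (simp add: cong_def)
next
  have *: "ext_class scale u \<subseteq> ext_class scale v" if "u \<doteq> v" for u v
  proof
    fix y assume "y \<in> ext_class scale u"
    then obtain x where x: "x \<in> ext_ideal scale" "y = x + u"
      unfolding ext_class_def a_r_coset_def' by auto
    have "y = (x + (u - v)) + v" "x + (u - v) \<in> ext_ideal scale"
      using x that ext_ideal_closed(2) by (auto simp: cong_def)
    thus "y \<in> ext_class scale v" unfolding ext_class_def a_r_coset_def' by fastforce
  qed
  assume "u \<doteq> v"
  thus "ext_class scale u = ext_class scale v" using *[of u v] *[of v u] cong_sym by blast
qed

lemma ext_class_zero: "\<zero>\<^bsub>ext_algebra scale\<^esub> = ext_class scale 0"
  by (auto simp: ext_algebra_def FactRing_def ext_class_def a_r_coset_def')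

lemma ext_class_carrier: "ext_class scale u \<in> carrier (ext_algebra scale)"
  by (auto simp: ext_algebra_def FactRing_def ext_class_def A_RCOSETS_def')

lemma ext_class_add:
  "ext_class scale u \<oplus>\<^bsub>ext_algebra scale\<^esub> ext_class scale v = ext_class scale (u + v)"
proof -
  interpret abelian_subgroup "ext_ideal scale" "ring_of_type_algebra :: ('a, 'm) free_alg ring"
    using ideal_ext_ideal ring_ring_of_type_algebra
    by (intro abelian_subgroupI3 ideal.axioms(1) ring.is_abelian_group)
  show ?thesis
    using a_rcos_sum[of u v] by (simp add: ext_algebra_def FactRing_def ext_class_def)
qed

lemma ext_class_finsum:
  assumes "finite A"
  shows "(\<Oplus>\<^bsub>ext_algebra scale\<^esub> x\<in>A. ext_class scale (h x)) = ext_class scale (\<Sum>x\<in>A. h x)"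
proof -
  interpret E: ring "ext_algebra scale" by (rule ring_ext_algebra)
  show ?thesis using assms
    by (induction A) (auto simp: ext_class_zero ext_class_carrier ext_class_add)
qed

lemma ext_scale_class: "ext_scale scale a (ext_class scale u) = ext_class scale (scalar a * u)"
  by (simp add: ext_scale_def ext_class_mult)

text \<open>The coefficients are taken homogeneous and embedded; \<open>keys_embed\<close> then
  places their classes in the required exterior power, including negative degrees.\<close>

lemma decomposition_of_mem_W:
  assumes "act u vac \<in> vectors.W n r (\<lambda>j. coord (w j)) t {0}" "homog d (act u vac) = act u vac"
  shows "\<exists>\<alpha>. (\<forall>J. \<alpha> J \<in> ext_power scale (d - int t)) \<and>
    ext_class scale u = (\<Oplus>\<^bsub>ext_algebra scale\<^esub> J \<in> {J. J \<subseteq> {1..r} \<and> card J = t}.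
      wedge_family scale w J \<otimes>\<^bsub>ext_algebra scale\<^esub> \<alpha> J)"
proof -
  interpret vectors n r "\<lambda>j. coord (w j)" .
  have wJ: "wJ J g = word_act (map w (sorted_list_of_set J)) g" for J g
    by (simp add: comp_def)
  obtain g where g: "\<And>J. homog (d - int t) (g J) = g J" "act u vac = (\<Sum>J\<in>subsets t. wJ J (g J))"
    using W_homogeneous[OF is_ideal_zero assms] by auto
  have "u \<doteq> embed (act u vac)"
    by (rule cong_sym[OF embed_act])
  also have "\<dots> = (\<Sum>J\<in>subsets t. embed (word_act (map w (sorted_list_of_set J)) (g J)))"
    by (simp only: g(2) embed_sum wJ)
  also have "\<dots> \<doteq> (\<Sum>J\<in>subsets t. pure_tensor (map w (sorted_list_of_set J)) * embed (g J))"
    by (intro cong_sum embed_word_mult)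
  finally have "ext_class scale u = (\<Oplus>\<^bsub>ext_algebra scale\<^esub> J \<in> subsets t.
      wedge_family scale w J \<otimes>\<^bsub>ext_algebra scale\<^esub> ext_class scale (embed (g J)))"
    unfolding wedge_family_def wedge_list_def ext_class_mult ext_class_finsum[OF finite_subsets]
    by (simp only: ext_class_eq_iff)
  moreover have "ext_class scale (embed (g J)) \<in> ext_power scale (d - int t)" for J
    unfolding ext_power_def ext_power_image_def using keys_embed[OF g(1)] by auto
  ultimately show ?thesis by (intro exI[of _ "\<lambda>J. ext_class scale (embed (g J))"]) blast
qed

end

text \<open>The supremum may be infinite, so one element of Q must be found that serves both
  inequalities. If the one chosen for the second is empty, then k < l and any nonempty list
  serves.\<close>

lemma enat_SUP_length:
  assumes "0 < Sup ((\<lambda>xs. enat (length xs)) ` Q)" "enat k < Sup ((\<lambda>xs. enat (length xs)) ` Q) + enat l"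
  shows "\<exists>xs\<in>Q. 0 < length xs \<and> k < length xs + l"
proof -
  obtain xs where xs: "xs \<in> Q" "0 < length xs"
    using assms(1) by (auto simp: less_SUP_iff zero_enat_def)
  have "\<exists>ys\<in>Q. k < length ys + l"
  proof (cases "k < l")
    case True
    thus ?thesis using xs(1) by auto
  next
    case False
    have "enat (k - l) < Sup ((\<lambda>xs. enat (length xs)) ` Q)"
    proof (rule ccontr)
      assume "\<not> ?thesis"
      hence "Sup ((\<lambda>xs. enat (length xs)) ` Q) + enat l \<le> enat (k - l) + enat l"
        by (intro add_right_mono) simp
      thus False using assms(2) False by simp
    qed
    then obtain ys where "ys \<in> Q" "k - l < length ys"
      by (auto simp: less_SUP_iff)
    thus ?thesis using False by (intro bexI[of _ ys]) auto
  qed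
  then obtain ys where ys: "ys \<in> Q" "k < length ys + l" by blast
  show ?thesis
  proof (cases "0 < length ys")
    case True
    thus ?thesis using ys by blast
  next
    case False
    thus ?thesis using xs ys by (intro bexI[of _ xs]) auto
  qed
qed

theorem theorem2p15:
  fixes scale :: "'a::comm_ring_1 \<Rightarrow> 'm::ab_group_add \<Rightarrow> 'm"
    and n r s k :: nat
    and e w :: "nat \<Rightarrow> 'm"
    and c :: "nat set \<Rightarrow> 'a"
    and I :: "'a set"
    and N :: "'m set"
    and \<omega> :: "('a, 'm) free_alg set"
  assumes "noetherian_ring (ring_of_type_algebra :: 'a ring)"
    and "Modules.module scale"
    and "inj_on e {1..n}"
    and "Modules.module.independent scale (e ` {1..n})"
    and "Modules.module.span scale (e ` {1..n}) = UNIV"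
    and "r \<ge> 1"
    and "wedge_family scale w {1..r} =
           (\<Oplus>\<^bsub>ext_algebra scale\<^esub> S \<in> {S. S \<subseteq> {1..n} \<and> card S = r}.
              ext_scale scale (c S) (wedge_family scale e S))"
    and "I = genideal ring_of_type_algebra (c ` {S. S \<subseteq> {1..n} \<and> card S = r})"
    and "N = Modules.module.span scale (w ` {1..r})"
    and "1 \<le> s" and "s \<le> r"
    and "\<omega> \<in> ext_power scale (int k)"
    and "\<forall>\<gamma> \<in> ext_power_image scale N (int s). \<gamma> \<otimes>\<^bsub>ext_algebra scale\<^esub> \<omega> = \<zero>\<^bsub>ext_algebra scale\<^esub>"
  shows
    "(\<exists>m::nat. \<forall>g \<in> I [^]\<^bsub>ideals_set ring_of_type_algebra\<^esub> m.
        \<exists>\<alpha>. (\<forall>J. J \<subseteq> {1..r} \<and> card J = r - s + 1 \<longrightarrow>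
                 \<alpha> J \<in> ext_power scale (int k - int r + int s - 1)) \<and>
            ext_scale scale g \<omega> =
              (\<Oplus>\<^bsub>ext_algebra scale\<^esub> J \<in> {J. J \<subseteq> {1..r} \<and> card J = r - s + 1}.
                 wedge_family scale w J \<otimes>\<^bsub>ext_algebra scale\<^esub> \<alpha> J))
     \<and>
     (0 < depth ring_of_type_algebra I \<and>
      enat k < depth ring_of_type_algebra I + enat (r - s) \<longrightarrow>
        (\<exists>\<alpha>. (\<forall>J. J \<subseteq> {1..r} \<and> card J = r - s + 1 \<longrightarrow>
                 \<alpha> J \<in> ext_power scale (int k - int r + int s - 1)) \<and>
            \<omega> =
              (\<Oplus>\<^bsub>ext_algebra scale\<^esub> J \<in> {J. J \<subseteq> {1..r} \<and> card J = r - s + 1}.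
                 wedge_family scale w J \<otimes>\<^bsub>ext_algebra scale\<^esub> \<alpha> J)))"
proof -
  interpret free_module scale e n
    by (intro free_module.intro free_module_axioms.intro assms(2-5))
  obtain u where u: "\<omega> = ext_class scale u"
    and keys_u: "\<And>v. v \<in> Poly_Mapping.keys u \<Longrightarrow> length (letters v) = k"
    using assms(12) unfolding ext_power_def ext_power_image_def by auto
  define f where "f = act u vac"
  have homog_f: "homog (int k) f = f"
    unfolding f_def by (rule homog_act[OF keys_u])
  interpret V: vectors n r "\<lambda>j. coord (w j)" .
  have wJ: "V.wJ J g = act (pure_tensor (map w (sorted_list_of_set J))) g" for J g
    by (simp add: comp_def)
  have fin: "finite {S. S \<subseteq> {1..n} \<and> card S = r}"
    by (rule finite_subset[of _ "Pow {1..n}"]) auto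
  \<comment> \<open>Applying the given expansion to the vacuum turns it into an identity of forms,
    whose coefficients are read off on the standard forms.\<close>
  have minors: "coef (V.wJ {1..r} vac) T = c T" if T: "T \<subseteq> {1..n}" "card T = r" for T
  proof -
    have "pure_tensor (map w (sorted_list_of_set {1..r})) \<doteq>
        (\<Sum>S | S \<subseteq> {1..n} \<and> card S = r. scalar (c S) * pure_tensor (map e (sorted_list_of_set S)))"
      using assms(7) unfolding wedge_family_def wedge_list_def ext_scale_class ext_class_finsum[OF fin]
      by (simp only: ext_class_eq_iff)
    from cong_act[OF this, of vac]
    have "V.wJ {1..r} vac =
        act (\<Sum>S | S \<subseteq> {1..n} \<and> card S = r. scalar (c S) * pure_tensor (map e (sorted_list_of_set S))) vac"
      by (simp only: wJ)
    also have "\<dots> = (\<Sum>S | S \<subseteq> {1..n} \<and> card S = r. smul (c S) (word_act (map e (sorted_list_of_set S)) vac))"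
      by (simp add: act_sum mult_single)
    finally have "coef (V.wJ {1..r} vac) T =
        (\<Sum>S | S \<subseteq> {1..n} \<and> card S = r. c S * coef (word_act (map e (sorted_list_of_set S)) vac) T)"
      by (simp only: coef_sum coef_smul)
    also have "\<dots> = (\<Sum>S | S \<subseteq> {1..n} \<and> card S = r. if S = T then c S else 0)"
    proof (rule sum.cong[OF refl])
      fix S assume S: "S \<in> {S. S \<subseteq> {1..n} \<and> card S = r}"
      hence "finite S" using finite_subset[of S "{1..n}"] by simp
      thus "c S * coef (word_act (map e (sorted_list_of_set S)) vac) T = (if S = T then c S else 0)"
        using word_act_basis_vac[of "sorted_list_of_set S" T] S by simp
    qed
    also have "\<dots> = c T"
      using T fin by (subst sum.delta) auto
    finally show ?thesis .
  qed
  interpret V: vectors_minors n r "\<lambda>j. coord (w j)" c I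
  proof
    fix q assume "is_ideal q" "\<And>S. S \<subseteq> {1..n} \<Longrightarrow> card S = r \<Longrightarrow> c S \<in> q"
    thus "I \<subseteq> q" unfolding assms(8) by (intro genideal_subset_is_ideal) auto
  qed (rule minors)
  \<comment> \<open>The product over K lies in the image of the s-th exterior power of N, because
    each of its vectors lies in N.\<close>
  have killed: "V.wJ K f = 0" if K: "K \<in> V.subsets s" for K
  proof -
    have "finite K" using K finite_subset[of K "{1..r}"] by simp
    hence "wedge_family scale w K \<in> ext_power_image scale N (int s)"
      unfolding wedge_family_def wedge_list_def ext_power_image_def assms(9)
      using K by (intro imageI) (auto intro: M.span_base)
    with assms(13) have "wedge_family scale w K \<otimes>\<^bsub>ext_algebra scale\<^esub> \<omega> = \<zero>\<^bsub>ext_algebra scale\<^esub>"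
      by blast
    hence "ext_class scale (pure_tensor (map w (sorted_list_of_set K)) * u) = ext_class scale 0"
      unfolding u wedge_family_def wedge_list_def ext_class_mult ext_class_zero .
    hence "pure_tensor (map w (sorted_list_of_set K)) * u \<doteq> 0"
      by (simp only: ext_class_eq_iff)
    from cong_act[OF this, of vac] show ?thesis
      by (simp only: wJ f_def act_mult act_zero)
  qed
  \<comment> \<open>This number is both the size of the index sets and the exponent m of part
    (a).\<close>
  define t where "t = r - s + 1"
  have t: "t + s = Suc r" "int k - int t = int k - int r + int s - 1"
    using \<open>s \<le> r\<close> by (simp_all add: t_def)
  \<comment> \<open>The scalar g lets one statement serve both parts: an element of the power of I
    in (a), and 1 in (b).\<close>
  have decomp: "\<exists>\<alpha>. (\<forall>J. J \<subseteq> {1..r} \<and> card J = r - s + 1 \<longrightarrow>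
        \<alpha> J \<in> ext_power scale (int k - int r + int s - 1)) \<and>
      ext_class scale (scalar g * u) =
        (\<Oplus>\<^bsub>ext_algebra scale\<^esub> J \<in> {J. J \<subseteq> {1..r} \<and> card J = r - s + 1}.
           wedge_family scale w J \<otimes>\<^bsub>ext_algebra scale\<^esub> \<alpha> J)"
    if "smul g f \<in> V.W t {0}" for g
  proof -
    have act: "act (scalar g * u) vac = smul g f"
      by (simp add: act_mult f_def zero_free_monoid_def)
    have "homog (int k) (smul g f) = smul g f"
      by (simp add: linop_smul[OF linop_homog] homog_f)
    with decomposition_of_mem_W[of "scalar g * u" r w t "int k"] that show ?thesis
      unfolding act t(2) unfolding t_def by blast
  qed
  show ?thesis
  proof (intro conjI impI)
    have "smul g f \<in> V.W t {0}" if "g \<in> I [^]\<^bsub>ideals_set ring_of_type_algebra\<^esub> t" for g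
      using V.ideal_power_mult[OF killed _ that] t(1) by simp
    thus "\<exists>m::nat. \<forall>g \<in> I [^]\<^bsub>ideals_set ring_of_type_algebra\<^esub> m.
        \<exists>\<alpha>. (\<forall>J. J \<subseteq> {1..r} \<and> card J = r - s + 1 \<longrightarrow>
                 \<alpha> J \<in> ext_power scale (int k - int r + int s - 1)) \<and>
            ext_scale scale g \<omega> =
              (\<Oplus>\<^bsub>ext_algebra scale\<^esub> J \<in> {J. J \<subseteq> {1..r} \<and> card J = r - s + 1}.
                 wedge_family scale w J \<otimes>\<^bsub>ext_algebra scale\<^esub> \<alpha> J)"
      unfolding u ext_scale_class using decomp by blast
  next
    assume d: "0 < depth ring_of_type_algebra I \<and>
      enat k < depth ring_of_type_algebra I + enat (r - s)"
    have "f \<in> V.W t {0}"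
    proof (cases "I = UNIV")
      case True
      \<comment> \<open>The depth is infinite by convention here and supplies no sequence; instead 1
        lies in I and its powers change nothing.\<close>
      hence "smul (1 ^ t) f \<in> V.W t {0}"
        using t(1) by (intro V.ideal_element_power[OF killed]) auto
      thus ?thesis by simp
    next
      case False
      define Q where "Q = {xs. set xs \<subseteq> I \<and> regular_sequence ring_of_type_algebra xs}"
      have dQ: "depth ring_of_type_algebra I = Sup ((\<lambda>xs. enat (length xs)) ` Q)"
        using False by (simp add: depth_def Q_def)
      obtain xs where xs: "xs \<in> Q" "0 < length xs" "k < length xs + (r - s)"
        using enat_SUP_length[of Q k "r - s"] d unfolding dQ by blast
      then obtain y ys where Cons: "xs = y # ys" by (cases xs) auto
      have "regular_mod (genideal ring_of_type_algebra (set [])) xs"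
        using xs(1) by (intro regular_mod_of_regular_sequence) (auto simp: Q_def regular_sequence_def)
      hence "regular_mod {0} (y # ys)" by (simp add: genideal_empty Cons)
      moreover have "set (y # ys) \<subseteq> I" using xs(1) by (simp add: Q_def Cons)
      moreover have "int k \<le> int (length ys) + int (r - s)" using xs(3) by (simp add: Cons)
      ultimately show ?thesis
        unfolding t_def using V.generalized_de_Rham killed \<open>s \<le> r\<close> homog_f by blast
    qed
    thus "\<exists>\<alpha>. (\<forall>J. J \<subseteq> {1..r} \<and> card J = r - s + 1 \<longrightarrow>
                 \<alpha> J \<in> ext_power scale (int k - int r + int s - 1)) \<and>
            \<omega> =
              (\<Oplus>\<^bsub>ext_algebra scale\<^esub> J \<in> {J. J \<subseteq> {1..r} \<and> card J = r - s + 1}.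
                 wedge_family scale w J \<otimes>\<^bsub>ext_algebra scale\<^esub> \<alpha> J)"
      using decomp[of 1] unfolding u by simp
  qed
qed

end
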